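(* Let $\mathcal T$ be a rigidly-compactly generated tensor-triangulated category with $\mathrm{Spc}(\mathcal T^c)$ a noetherian topological space. Then $\mathcal T$ satisfies the local-to-global principle: for every $t\in\mathcal T$, $$\mathrm{Loc}_\otimes\langle t\rangle=\mathrm{Loc}_\otimes\langle t\otimes g(\mathcal P)\mid\mathcal P\in\mathrm{Spc}(\mathcal T^c)\rangle.$$
   Context: A tensor-triangulated category is a triangulated category with a compatible closed symmetric monoidal structure $(\otimes,\mathbb 1)$. It is rigidly-compactly generated if it is compactly generated as a triangulated category (in particular has all small coproducts) and its compact objects coincide with its rigid (dualizable) objects; in particular $\mathbb 1$ is compact. $\mathcal T^c$ is the full subcategory of compact objects. A localizing $\otimes$-ideal is a triangulated subcategory closed under coproducts and under tensoring with arbitrary objects; $\mathrm{Loc}_\otimes\langle\mathcal E\rangle$ is the smallest one containing $\mathcal E$. $\mathrm{Spc}(\mathcal T^c)$ is the Balmer spectrum: the set of prime thick $\otimes$-ideals of $\mathcal T^c$, with the sets $\mathrm{supp}(x)=\{\mathcal P : x\notin\mathcal P\}$, $x\in\mathcal T^c$, as a basis of closed sets; it is a spectral space. A subset of a spectral space is Thomason if it is a union of closed subsets each with quasi-compact complement. For $Y\subseteq\mathrm{Spc}(\mathcal T^c)$ Thomason put $\mathcal T^c_Y=\{x\in\mathcal T^c:\mathrm{supp}(x)\subseteq Y\}$; there is an (essentially unique) exact triangle $e_Y\to\mathbb 1\to f_Y\to\Sigma e_Y$ with $e_Y\otimes f_Y=0$ and $\mathrm{Loc}_\otimes\langle e_Y\rangle=\mathrm{Ker}(f_Y\otimes-)=\mathrm{Loc}\langle\mathcal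 T^c_Y\rangle$. If $\{\mathcal P\}=Y_1\cap Y_2^c$ with $Y_1,Y_2$ Thomason, put $g(\mathcal P)=e_{Y_1}\otimes f_{Y_2}$ (independent of the choice of $Y_1,Y_2$ up to isomorphism); when the spectrum is noetherian such $Y_1,Y_2$ exist for every point $\mathcal P$. *)

theory Defs
  imports "HOL-Analysis.Abstract_Topology" "HOL-Algebra.FiniteProduct"
begin

unbundle cardinal_syntax

section \<open>Smallness\<close>

text \<open>
  The cardinality of the type \<open>'u\<close> plays the role of a Grothendieck universe: a set is small if it
  has fewer elements than \<open>'u\<close>, and \<open>|'u|\<close> is required to be strongly inaccessible. Up to
  bijection, the small sets are the small subsets of \<open>'u\<close>, so small families are indexed by those.
\<close>

definition small :: "'u itself \<Rightarrow> 'b set \<Rightarrow> bool" where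
  "small U A \<longleftrightarrow> |A| <o |UNIV :: 'u set|"

definition universe :: "'u itself \<Rightarrow> bool" where
  "universe U \<longleftrightarrow>
     natLeq <o |UNIV :: 'u set| \<and>
     regularCard |UNIV :: 'u set| \<and>
     (\<forall>A :: 'u set. small U A \<longrightarrow> small U (Pow A))"


section \<open>Additive categories\<close>

text \<open>
  All elements of \<open>'o\<close> are objects and all elements of \<open>'a\<close> are morphisms; composition and
  addition are only meaningful on composable, respectively parallel, morphisms.
\<close>

record ('o, 'a) cat =
  src :: "'a \<Rightarrow> 'o"
  tgt :: "'a \<Rightarrow> 'o"
  ident :: "'o \<Rightarrow> 'a"
  cmp :: "'a \<Rightarrow> 'a \<Rightarrow> 'a" (infixr "\<cdot>\<index>" 70)

definition Hom :: "('o, 'a, 'm) cat_scheme \<Rightarrow> 'o \<Rightarrow> 'o \<Rightarrow> 'a set" where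
  "Hom C X Y = {f. src C f = X \<and> tgt C f = Y}"

definition inverse_arrows :: "('o, 'a, 'm) cat_scheme \<Rightarrow> 'a \<Rightarrow> 'a \<Rightarrow> bool" where
  "inverse_arrows C f g \<longleftrightarrow>
     g \<in> Hom C (tgt C f) (src C f) \<and>
     cmp C g f = ident C (src C f) \<and> cmp C f g = ident C (tgt C f)"

definition iso_arrow :: "('o, 'a, 'm) cat_scheme \<Rightarrow> 'a \<Rightarrow> bool" where
  "iso_arrow C f \<longleftrightarrow> (\<exists>g. inverse_arrows C f g)"

definition isomorphic :: "('o, 'a, 'm) cat_scheme \<Rightarrow> 'o \<Rightarrow> 'o \<Rightarrow> bool" where
  "isomorphic C X Y \<longleftrightarrow> (\<exists>f \<in> Hom C X Y. iso_arrow C f)"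

locale category =
  fixes C :: "('o, 'a, 'm) cat_scheme" (structure)
  assumes ident_in_Hom: "ident C X \<in> Hom C X X"
    and cmp_in_Hom: "\<lbrakk>f \<in> Hom C X Y; g \<in> Hom C Y Z\<rbrakk> \<Longrightarrow> g \<cdot> f \<in> Hom C X Z"
    and cmp_ident_left: "f \<in> Hom C X Y \<Longrightarrow> ident C Y \<cdot> f = f"
    and cmp_ident_right: "f \<in> Hom C X Y \<Longrightarrow> f \<cdot> ident C X = f"
    and cmp_assoc: "\<lbrakk>f \<in> Hom C W X; g \<in> Hom C X Y; h \<in> Hom C Y Z\<rbrakk> \<Longrightarrow>
        (h \<cdot> g) \<cdot> f = h \<cdot> (g \<cdot> f)"

record ('o, 'a) add_cat = "('o, 'a) cat" +
  zero_arrow :: "'o \<Rightarrow> 'o \<Rightarrow> 'a"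
  plus_arrow :: "'a \<Rightarrow> 'a \<Rightarrow> 'a"

definition hom_group :: "('o, 'a, 'm) add_cat_scheme \<Rightarrow> 'o \<Rightarrow> 'o \<Rightarrow> 'a monoid" where
  "hom_group C X Y = \<lparr>carrier = Hom C X Y, monoid.mult = plus_arrow C, one = zero_arrow C X Y\<rparr>"

definition neg_arrow :: "('o, 'a, 'm) add_cat_scheme \<Rightarrow> 'a \<Rightarrow> 'a" where
  "neg_arrow C f = m_inv (hom_group C (src C f) (tgt C f)) f"

definition is_zero :: "('o, 'a, 'm) add_cat_scheme \<Rightarrow> 'o \<Rightarrow> bool" where
  "is_zero C X \<longleftrightarrow> ident C X = zero_arrow C X X"

definition is_biproduct :: "('o, 'a, 'm) add_cat_scheme \<Rightarrow> 'o \<Rightarrow> 'o \<Rightarrow> 'o \<Rightarrow> bool" where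
  "is_biproduct C B X Y \<longleftrightarrow>
     (\<exists>i \<in> Hom C X B. \<exists>j \<in> Hom C Y B. \<exists>p \<in> Hom C B X. \<exists>q \<in> Hom C B Y.
        cmp C p i = ident C X \<and> cmp C q j = ident C Y \<and>
        cmp C q i = zero_arrow C X Y \<and> cmp C p j = zero_arrow C Y X \<and>
        plus_arrow C (cmp C i p) (cmp C j q) = ident C B)"

locale additive_category = category C
  for C :: "('o, 'a, 'm) add_cat_scheme" (structure) +
  assumes hom_comm_group: "comm_group (hom_group C X Y)"
    and cmp_plus_left: "\<lbrakk>f \<in> Hom C X Y; g \<in> Hom C Y Z; g' \<in> Hom C Y Z\<rbrakk> \<Longrightarrow>
        plus_arrow C g g' \<cdot> f = plus_arrow C (g \<cdot> f) (g' \<cdot> f)"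
    and cmp_plus_right: "\<lbrakk>f \<in> Hom C X Y; f' \<in> Hom C X Y; g \<in> Hom C Y Z\<rbrakk> \<Longrightarrow>
        g \<cdot> plus_arrow C f f' = plus_arrow C (g \<cdot> f) (g \<cdot> f')"
    and ex_zero_object: "\<exists>Z. is_zero C Z"
    and ex_biproduct: "\<exists>B. is_biproduct C B X Y"


section \<open>Triangulated categories\<close>

text \<open>
  \<open>dist T f g h\<close> means that \<open>f : X \<rightarrow> Y\<close>, \<open>g : Y \<rightarrow> Z\<close>, \<open>h : Z \<rightarrow> \<Sigma>X\<close> form an exact triangle.
\<close>

record ('o, 'a) tri_cat = "('o, 'a) add_cat" +
  susp :: "'o \<Rightarrow> 'o"
  susp_arrow :: "'a \<Rightarrow> 'a"
  dist :: "'a \<Rightarrow> 'a \<Rightarrow> 'a \<Rightarrow> bool"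

locale triangulated_category = additive_category T
  for T :: "('o, 'a, 'm) tri_cat_scheme" (structure) +
  assumes susp_in_Hom: "f \<in> Hom T X Y \<Longrightarrow> susp_arrow T f \<in> Hom T (susp T X) (susp T Y)"
    and susp_ident: "susp_arrow T (ident T X) = ident T (susp T X)"
    and susp_cmp: "\<lbrakk>f \<in> Hom T X Y; g \<in> Hom T Y Z\<rbrakk> \<Longrightarrow>
        susp_arrow T (g \<cdot> f) = susp_arrow T g \<cdot> susp_arrow T f"
    and susp_plus: "\<lbrakk>f \<in> Hom T X Y; g \<in> Hom T X Y\<rbrakk> \<Longrightarrow>
        susp_arrow T (plus_arrow T f g) = plus_arrow T (susp_arrow T f) (susp_arrow T g)"
    and susp_fully_faithful:
      "bij_betw (susp_arrow T) (Hom T X Y) (Hom T (susp T X) (susp T Y))"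
    and susp_essentially_surjective: "\<exists>X. isomorphic T (susp T X) Y"
    and dist_arrows: "dist T f g h \<Longrightarrow>
        tgt T f = src T g \<and> tgt T g = src T h \<and> tgt T h = susp T (src T f)"
    and dist_iso: "\<lbrakk>dist T f g h; f \<in> Hom T X Y; g \<in> Hom T Y Z; h \<in> Hom T Z (susp T X);
        f' \<in> Hom T X' Y'; g' \<in> Hom T Y' Z'; h' \<in> Hom T Z' (susp T X');
        u \<in> Hom T X X'; v \<in> Hom T Y Y'; w \<in> Hom T Z Z';
        iso_arrow T u; iso_arrow T v; iso_arrow T w;
        v \<cdot> f = f' \<cdot> u; w \<cdot> g = g' \<cdot> v; susp_arrow T u \<cdot> h = h' \<cdot> w\<rbrakk> \<Longrightarrow>
        dist T f' g' h'"
    and dist_ident: "is_zero T Z \<Longrightarrow>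
        dist T (ident T X) (zero_arrow T X Z) (zero_arrow T Z (susp T X))"
    and ex_dist: "\<exists>g h. dist T f g h"
    and dist_rotate: "\<lbrakk>f \<in> Hom T X Y; g \<in> Hom T Y Z; h \<in> Hom T Z (susp T X)\<rbrakk> \<Longrightarrow>
        dist T f g h \<longleftrightarrow> dist T g h (neg_arrow T (susp_arrow T f))"
    and dist_morphism: "\<lbrakk>dist T f g h; f \<in> Hom T X Y; g \<in> Hom T Y Z;
        dist T f' g' h'; f' \<in> Hom T X' Y'; g' \<in> Hom T Y' Z';
        u \<in> Hom T X X'; v \<in> Hom T Y Y'; v \<cdot> f = f' \<cdot> u\<rbrakk> \<Longrightarrow>
        \<exists>w \<in> Hom T Z Z'. w \<cdot> g = g' \<cdot> v \<and> susp_arrow T u \<cdot> h = h' \<cdot> w"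
    and octahedral: "\<lbrakk>f \<in> Hom T X Y; g \<in> Hom T Y Z;
        dist T f f' f''; dist T g g' g''; dist T (g \<cdot> f) h' h''\<rbrakk> \<Longrightarrow>
        \<exists>u \<in> Hom T (tgt T f') (tgt T h'). \<exists>v \<in> Hom T (tgt T h') (tgt T g').
          dist T u v (susp_arrow T f' \<cdot> g'') \<and>
          u \<cdot> f' = h' \<cdot> g \<and> h'' \<cdot> u = f'' \<and>
          v \<cdot> h' = g' \<and> g'' \<cdot> v = susp_arrow T f \<cdot> h''"


section \<open>Tensor-triangulated categories\<close>

text \<open>
  \<open>associator T X Y Z : (X \<otimes> Y) \<otimes> Z \<rightarrow> X \<otimes> (Y \<otimes> Z)\<close>, \<open>left_unitor T X : \<one> \<otimes> X \<rightarrow> X\<close>,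
  \<open>right_unitor T X : X \<otimes> \<one> \<rightarrow> X\<close>, \<open>symm T X Y : X \<otimes> Y \<rightarrow> Y \<otimes> X\<close> and
  \<open>susp_tensor T X Y : \<Sigma>X \<otimes> Y \<rightarrow> \<Sigma>(X \<otimes> Y)\<close>.
\<close>

record ('o, 'a) tt_cat = "('o, 'a) tri_cat" +
  tensor :: "'o \<Rightarrow> 'o \<Rightarrow> 'o" (infixr "\<boxtimes>\<index>" 75)
  tensor_arrow :: "'a \<Rightarrow> 'a \<Rightarrow> 'a" (infixr "\<star>\<index>" 75)
  tunit :: 'o
  associator :: "'o \<Rightarrow> 'o \<Rightarrow> 'o \<Rightarrow> 'a"
  left_unitor :: "'o \<Rightarrow> 'a"
  right_unitor :: "'o \<Rightarrow> 'a"
  symm :: "'o \<Rightarrow> 'o \<Rightarrow> 'a"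
  susp_tensor :: "'o \<Rightarrow> 'o \<Rightarrow> 'a"

locale symmetric_monoidal_category = category T
  for T :: "('o, 'a, 'm) tt_cat_scheme" (structure) +
  assumes tensor_in_Hom: "\<lbrakk>f \<in> Hom T X Y; f' \<in> Hom T X' Y'\<rbrakk> \<Longrightarrow>
        f \<star> f' \<in> Hom T (X \<boxtimes> X') (Y \<boxtimes> Y')"
    and tensor_ident: "ident T X \<star> ident T Y = ident T (X \<boxtimes> Y)"
    and tensor_cmp: "\<lbrakk>f \<in> Hom T X Y; g \<in> Hom T Y Z; f' \<in> Hom T X' Y'; g' \<in> Hom T Y' Z'\<rbrakk> \<Longrightarrow>
        (g \<cdot> f) \<star> (g' \<cdot> f') = (g \<star> g') \<cdot> (f \<star> f')"
    and associator_in_Hom: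
      "associator T X Y Z \<in> Hom T ((X \<boxtimes> Y) \<boxtimes> Z) (X \<boxtimes> (Y \<boxtimes> Z))"
    and associator_iso: "iso_arrow T (associator T X Y Z)"
    and associator_natural: "\<lbrakk>f \<in> Hom T X X'; g \<in> Hom T Y Y'; h \<in> Hom T Z Z'\<rbrakk> \<Longrightarrow>
        associator T X' Y' Z' \<cdot> ((f \<star> g) \<star> h) = (f \<star> (g \<star> h)) \<cdot> associator T X Y Z"
    and left_unitor_in_Hom: "left_unitor T X \<in> Hom T (tunit T \<boxtimes> X) X"
    and left_unitor_iso: "iso_arrow T (left_unitor T X)"
    and left_unitor_natural: "f \<in> Hom T X Y \<Longrightarrow>
        left_unitor T Y \<cdot> (ident T (tunit T) \<star> f) = f \<cdot> left_unitor T X"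
    and right_unitor_in_Hom: "right_unitor T X \<in> Hom T (X \<boxtimes> tunit T) X"
    and right_unitor_iso: "iso_arrow T (right_unitor T X)"
    and right_unitor_natural: "f \<in> Hom T X Y \<Longrightarrow>
        right_unitor T Y \<cdot> (f \<star> ident T (tunit T)) = f \<cdot> right_unitor T X"
    and symm_in_Hom: "symm T X Y \<in> Hom T (X \<boxtimes> Y) (Y \<boxtimes> X)"
    and symm_symm: "symm T Y X \<cdot> symm T X Y = ident T (X \<boxtimes> Y)"
    and symm_natural: "\<lbrakk>f \<in> Hom T X X'; g \<in> Hom T Y Y'\<rbrakk> \<Longrightarrow>
        symm T X' Y' \<cdot> (f \<star> g) = (g \<star> f) \<cdot> symm T X Y"
    and pentagon:
      "associator T W X (Y \<boxtimes> Z) \<cdot> associator T (W \<boxtimes> X) Y Z =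
       (ident T W \<star> associator T X Y Z) \<cdot> associator T W (X \<boxtimes> Y) Z \<cdot>
         (associator T W X Y \<star> ident T Z)"
    and unit_triangle:
      "(ident T X \<star> left_unitor T Y) \<cdot> associator T X (tunit T) Y =
       right_unitor T X \<star> ident T Y"
    and hexagon:
      "associator T Y Z X \<cdot> symm T X (Y \<boxtimes> Z) \<cdot> associator T X Y Z =
       (ident T Y \<star> symm T X Z) \<cdot> associator T Y X Z \<cdot> (symm T X Y \<star> ident T Z)"

definition is_internal_hom ::
    "('o, 'a, 'm) tt_cat_scheme \<Rightarrow> 'o \<Rightarrow> 'o \<Rightarrow> 'o \<Rightarrow> 'a \<Rightarrow> bool" where
  "is_internal_hom T X Y H ev \<longleftrightarrow>
     ev \<in> Hom T (tensor T H X) Y \<and>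
     (\<forall>Z. \<forall>k \<in> Hom T (tensor T Z X) Y.
        \<exists>!h. h \<in> Hom T Z H \<and> cmp T ev (tensor_arrow T h (ident T X)) = k)"

text \<open>
  Compatibility of the monoidal structure with the triangulation: the tensor product is exact in
  its first variable (hence, by symmetry, in each variable) by means of natural isomorphisms
  \<open>\<Sigma>X \<otimes> Y \<cong> \<Sigma>(X \<otimes> Y)\<close> that are coherent with the right unitor and the associator, and the
  symmetry is graded-commutative, i.e. it acts as \<open>-1\<close> on \<open>\<Sigma>\<one> \<otimes> \<Sigma>\<one>\<close>.
\<close>

locale tensor_triangulated_category =
  triangulated_category T + symmetric_monoidal_category T
  for T :: "('o, 'a, 'm) tt_cat_scheme" (structure) +
  assumes ex_internal_hom: "\<exists>H ev. is_internal_hom T X Y H ev"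
    and tensor_plus: "\<lbrakk>f \<in> Hom T X Y; g \<in> Hom T X Y; h \<in> Hom T X' Y'\<rbrakk> \<Longrightarrow>
        plus_arrow T f g \<star> h = plus_arrow T (f \<star> h) (g \<star> h)"
    and susp_tensor_in_Hom:
      "susp_tensor T X Y \<in> Hom T (susp T X \<boxtimes> Y) (susp T (X \<boxtimes> Y))"
    and susp_tensor_iso: "iso_arrow T (susp_tensor T X Y)"
    and susp_tensor_natural: "\<lbrakk>f \<in> Hom T X X'; g \<in> Hom T Y Y'\<rbrakk> \<Longrightarrow>
        susp_tensor T X' Y' \<cdot> (susp_arrow T f \<star> g) = susp_arrow T (f \<star> g) \<cdot> susp_tensor T X Y"
    and susp_tensor_unit:
      "susp_arrow T (right_unitor T X) \<cdot> susp_tensor T X (tunit T) = right_unitor T (susp T X)"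
    and susp_tensor_assoc:
      "susp_arrow T (associator T X Y Z) \<cdot> susp_tensor T (X \<boxtimes> Y) Z \<cdot>
         (susp_tensor T X Y \<star> ident T Z) =
       susp_tensor T X (Y \<boxtimes> Z) \<cdot> associator T (susp T X) Y Z"
    and tensor_exact: "\<lbrakk>dist T f g h; f \<in> Hom T X Y\<rbrakk> \<Longrightarrow>
        dist T (f \<star> ident T W) (g \<star> ident T W) (susp_tensor T X W \<cdot> (h \<star> ident T W))"
    and symm_susp_unit:
      "symm T (susp T (tunit T)) (susp T (tunit T)) =
       neg_arrow T (ident T (susp T (tunit T) \<boxtimes> susp T (tunit T)))"

definition rigid :: "('o, 'a, 'm) tt_cat_scheme \<Rightarrow> 'o \<Rightarrow> bool" where
  "rigid T X \<longleftrightarrow>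
     (\<exists>D. \<exists>ev \<in> Hom T (tensor T D X) (tunit T). \<exists>coev \<in> Hom T (tunit T) (tensor T X D).
        cmp T (right_unitor T X) (cmp T (tensor_arrow T (ident T X) ev)
          (cmp T (associator T X D X) (tensor_arrow T coev (ident T X)))) = left_unitor T X \<and>
        (\<exists>a. inverse_arrows T (associator T D X D) a \<and>
          cmp T (left_unitor T D) (cmp T (tensor_arrow T ev (ident T D))
            (cmp T a (tensor_arrow T (ident T D) coev))) = right_unitor T D))"


section \<open>Coproducts and compact generation\<close>

definition is_coproduct ::
    "('o, 'a, 'm) cat_scheme \<Rightarrow> 'i set \<Rightarrow> ('i \<Rightarrow> 'o) \<Rightarrow> 'o \<Rightarrow> ('i \<Rightarrow> 'a) \<Rightarrow> bool" where
  "is_coproduct C I X S \<iota> \<longleftrightarrow>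
     (\<forall>i \<in> I. \<iota> i \<in> Hom C (X i) S) \<and>
     (\<forall>Z h. (\<forall>i \<in> I. h i \<in> Hom C (X i) Z) \<longrightarrow>
        (\<exists>!k. k \<in> Hom C S Z \<and> (\<forall>i \<in> I. cmp C k (\<iota> i) = h i)))"

definition has_small_coproducts :: "'u itself \<Rightarrow> ('o, 'a, 'm) cat_scheme \<Rightarrow> bool" where
  "has_small_coproducts U C \<longleftrightarrow>
     (\<forall>(I :: 'u set) X. small U I \<longrightarrow> (\<exists>S \<iota>. is_coproduct C I X S \<iota>))"

definition locally_small :: "'u itself \<Rightarrow> ('o, 'a, 'm) cat_scheme \<Rightarrow> bool" where
  "locally_small U C \<longleftrightarrow> (\<forall>X Y. small U (Hom C X Y))"

definition hom_direct_sum ::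
    "('o, 'a, 'm) add_cat_scheme \<Rightarrow> 'o \<Rightarrow> 'i set \<Rightarrow> ('i \<Rightarrow> 'o) \<Rightarrow> ('i \<Rightarrow> 'a) set" where
  "hom_direct_sum C c I X =
     {\<phi> \<in> (\<Pi>\<^sub>E i\<in>I. Hom C c (X i)). finite {i \<in> I. \<phi> i \<noteq> zero_arrow C c (X i)}}"

text \<open>
  Compactness: the canonical map \<open>\<Oplus>\<^sub>i Hom(c, X\<^sub>i) \<rightarrow> Hom(c, \<Coprod>\<^sub>i X\<^sub>i)\<close> is bijective for all small
  coproducts. Hom groups are multiplicative monoids for the library, so \<^const>\<open>finprod\<close> is a sum.
\<close>

definition compact_object :: "'u itself \<Rightarrow> ('o, 'a, 'm) add_cat_scheme \<Rightarrow> 'o \<Rightarrow> bool" where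
  "compact_object U C c \<longleftrightarrow>
     (\<forall>(I :: 'u set) X S \<iota>. small U I \<and> is_coproduct C I X S \<iota> \<longrightarrow>
        bij_betw
          (\<lambda>\<phi>. finprod (hom_group C c S) (\<lambda>i. cmp C (\<iota> i) (\<phi> i))
                 {i \<in> I. \<phi> i \<noteq> zero_arrow C c (X i)})
          (hom_direct_sum C c I X) (Hom C c S))"

definition compactly_generated :: "'u itself \<Rightarrow> ('o, 'a, 'm) add_cat_scheme \<Rightarrow> bool" where
  "compactly_generated U C \<longleftrightarrow>
     has_small_coproducts U C \<and>
     (\<exists>G. small U G \<and> (\<forall>c \<in> G. compact_object U C c) \<and>
        (\<forall>X. (\<forall>c \<in> G. Hom C c X = {zero_arrow C c X}) \<longrightarrow> is_zero C X))"

definition rigidly_compactly_generated :: "'u itself \<Rightarrow> ('o, 'a, 'm) tt_cat_scheme \<Rightarrow> bool" where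
  "rigidly_compactly_generated U T \<longleftrightarrow>
     tensor_triangulated_category T \<and> locally_small U T \<and> compactly_generated U T \<and>
     (\<forall>X. compact_object U T X \<longleftrightarrow> rigid T X)"


section \<open>Localizing subcategories\<close>

text \<open>Full replete subcategories are represented by their sets of objects.\<close>

definition triangulated_subcategory :: "('o, 'a, 'm) tri_cat_scheme \<Rightarrow> 'o set \<Rightarrow> bool" where
  "triangulated_subcategory T L \<longleftrightarrow>
     (\<forall>X. is_zero T X \<longrightarrow> X \<in> L) \<and>
     (\<forall>X Y. X \<in> L \<and> isomorphic T X Y \<longrightarrow> Y \<in> L) \<and>
     (\<forall>X. susp T X \<in> L \<longleftrightarrow> X \<in> L) \<and>
     (\<forall>f g h. dist T f g h \<and> src T f \<in> L \<and> tgt T f \<in> L \<longrightarrow> tgt T g \<in> L)"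

definition localizing :: "'u itself \<Rightarrow> ('o, 'a, 'm) tri_cat_scheme \<Rightarrow> 'o set \<Rightarrow> bool" where
  "localizing U T L \<longleftrightarrow>
     triangulated_subcategory T L \<and>
     (\<forall>(I :: 'u set) X S \<iota>.
        small U I \<and> (\<forall>i \<in> I. X i \<in> L) \<and> is_coproduct T I X S \<iota> \<longrightarrow> S \<in> L)"

definition localizing_ideal :: "'u itself \<Rightarrow> ('o, 'a, 'm) tt_cat_scheme \<Rightarrow> 'o set \<Rightarrow> bool" where
  "localizing_ideal U T L \<longleftrightarrow>
     localizing U T L \<and> (\<forall>X \<in> L. \<forall>Y. tensor T X Y \<in> L)"

definition Loc :: "'u itself \<Rightarrow> ('o, 'a, 'm) tri_cat_scheme \<Rightarrow> 'o set \<Rightarrow> 'o set" where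
  "Loc U T E = \<Inter> {L. localizing U T L \<and> E \<subseteq> L}"

definition Loc_tensor :: "'u itself \<Rightarrow> ('o, 'a, 'm) tt_cat_scheme \<Rightarrow> 'o set \<Rightarrow> 'o set" where
  "Loc_tensor U T E = \<Inter> {L. localizing_ideal U T L \<and> E \<subseteq> L}"


section \<open>The Balmer spectrum\<close>

definition compact_part :: "'u itself \<Rightarrow> ('o, 'a, 'm) add_cat_scheme \<Rightarrow> 'o set" where
  "compact_part U T = {X. compact_object U T X}"

definition thick_ideal :: "'u itself \<Rightarrow> ('o, 'a, 'm) tt_cat_scheme \<Rightarrow> 'o set \<Rightarrow> bool" where
  "thick_ideal U T J \<longleftrightarrow>
     J \<subseteq> compact_part U T \<and>
     triangulated_subcategory T J \<and>
     (\<forall>B X Y. is_biproduct T B X Y \<and> B \<in> J \<longrightarrow> X \<in> J \<and> Y \<in> J) \<and>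
     (\<forall>X \<in> J. \<forall>Y \<in> compact_part U T. tensor T X Y \<in> J)"

definition prime_ideals :: "'u itself \<Rightarrow> ('o, 'a, 'm) tt_cat_scheme \<Rightarrow> 'o set set" where
  "prime_ideals U T =
     {P. thick_ideal U T P \<and> P \<noteq> compact_part U T \<and>
         (\<forall>X \<in> compact_part U T. \<forall>Y \<in> compact_part U T.
            tensor T X Y \<in> P \<longrightarrow> X \<in> P \<or> Y \<in> P)}"

definition supp :: "'u itself \<Rightarrow> ('o, 'a, 'm) tt_cat_scheme \<Rightarrow> 'o \<Rightarrow> 'o set set" where
  "supp U T X = {P \<in> prime_ideals U T. X \<notin> P}"

definition Spc :: "'u itself \<Rightarrow> ('o, 'a, 'm) tt_cat_scheme \<Rightarrow> 'o set topology" where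
  "Spc U T = topology_generated_by
     {prime_ideals U T - supp U T X | X. X \<in> compact_part U T}"

definition noetherian_space :: "'p topology \<Rightarrow> bool" where
  "noetherian_space S \<longleftrightarrow>
     (\<forall>Z :: nat \<Rightarrow> 'p set. (\<forall>n. closedin S (Z n) \<and> Z (Suc n) \<subseteq> Z n) \<longrightarrow>
        (\<exists>N. \<forall>n \<ge> N. Z n = Z N))"

definition thomason :: "'p topology \<Rightarrow> 'p set \<Rightarrow> bool" where
  "thomason S Y \<longleftrightarrow>
     (\<exists>F. (\<forall>Z \<in> F. closedin S Z \<and> compactin S (topspace S - Z)) \<and> Y = \<Union> F)"

definition compact_supported ::
    "'u itself \<Rightarrow> ('o, 'a, 'm) tt_cat_scheme \<Rightarrow> 'o set set \<Rightarrow> 'o set" where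
  "compact_supported U T Y = {X \<in> compact_part U T. supp U T X \<subseteq> Y}"


section \<open>Idempotent triangles\<close>

definition idempotent_triangle ::
    "'u itself \<Rightarrow> ('o, 'a, 'm) tt_cat_scheme \<Rightarrow> 'o set set \<Rightarrow> 'o \<Rightarrow> 'o \<Rightarrow> bool" where
  "idempotent_triangle U T Y e f \<longleftrightarrow>
     (\<exists>a \<in> Hom T e (tunit T). \<exists>b \<in> Hom T (tunit T) f. \<exists>c \<in> Hom T f (susp T e). dist T a b c) \<and>
     is_zero T (tensor T e f) \<and>
     Loc_tensor U T {e} = {X. is_zero T (tensor T f X)} \<and>
     {X. is_zero T (tensor T f X)} = Loc U T (compact_supported U T Y)"

text \<open>
  The objects \<open>e\<^sub>Y\<close> and \<open>f\<^sub>Y\<close> are determined by \<open>Y\<close> only up to isomorphism; the functions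
  \<open>e\<close> and \<open>f\<close> stand for a choice of such a triangle for every Thomason subset.
\<close>

definition idempotent_choice ::
    "'u itself \<Rightarrow> ('o, 'a, 'm) tt_cat_scheme \<Rightarrow>
      ('o set set \<Rightarrow> 'o) \<Rightarrow> ('o set set \<Rightarrow> 'o) \<Rightarrow> bool" where
  "idempotent_choice U T e f \<longleftrightarrow>
     (\<forall>Y. thomason (Spc U T) Y \<longrightarrow> idempotent_triangle U T Y (e Y) (f Y))"

definition point_idempotent ::
    "'u itself \<Rightarrow> ('o, 'a, 'm) tt_cat_scheme \<Rightarrow>
      ('o set set \<Rightarrow> 'o) \<Rightarrow> ('o set set \<Rightarrow> 'o) \<Rightarrow> 'o set \<Rightarrow> 'o \<Rightarrow> bool" where
  "point_idempotent U T e f P x \<longleftrightarrow>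
     (\<exists>Y1 Y2. thomason (Spc U T) Y1 \<and> thomason (Spc U T) Y2 \<and>
        {P} = Y1 \<inter> (prime_ideals U T - Y2) \<and> x = tensor T (e Y1) (f Y2))"

end

theory Submission
  imports Defs
begin

text \<open>
  Fix a localizing ideal \<open>L\<close> containing all \<open>t \<otimes> g(P)\<close>. The objects \<open>z\<close> with \<open>z \<otimes> t \<in> L\<close> form a
  localizing ideal \<open>M\<close>, and the claim is \<open>\<one> \<in> M\<close>. Otherwise the noetherian hypothesis yields a compact
  \<open>x \<notin> M\<close> of minimal support. The compact objects in \<open>M\<close> form a radical thick ideal, so they lie in a
  prime \<open>P\<close> with \<open>x \<notin> P\<close>, and minimality shows that \<open>supp(x)\<close> is the closure of \<open>P\<close>. If
  \<open>{P} = Y\<^sub>1 \<inter> Y\<^sub>2\<^sup>c\<close>, then \<open>supp(x) \<subseteq> Y\<^sub>1\<close>, so \<open>e(Y\<^sub>1) \<otimes> f(Y\<^sub>2) \<in> M\<close> gives \<open>x \<otimes> f(Y\<^sub>2) \<in> M\<close>; and \<open>x \<otimes> e(Y\<^sub>2) \<in> M\<close>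
  because \<open>e(Y\<^sub>2)\<close> is built from compact objects \<open>y\<close> with \<open>P \<notin> supp(y)\<close>, for which the support of
  \<open>x \<otimes> y\<close> is strictly smaller. Hence \<open>x \<in> M\<close>, a contradiction.
\<close>

text \<open>Minimality is imposed on the support of an object, not on a closed set, so a single
  counterexample replaces any induction over the spectrum. The price is that primes must be produced
  from \<open>M\<close> alone, and this shapes the preparation. The compact objects in
  \<open>M\<close> must be closed under summands, while a localizing subcategory is by definition
  closed only under cones, suspensions and coproducts; hence the swindle. They must form a radical
  ideal, because a prime omitting \<open>x\<close> arises from an ideal that is maximal among those
  avoiding all tensor powers of \<open>x\<close>. Radicality comes from rigidity: if
  \<open>x\<close> has dual \<open>D\<close>, it is a retract of
  \<open>x \<otimes> D \<otimes> x\<close>, so \<open>x \<otimes> x \<in> M\<close> suffices.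
  Rigidity also makes tensor products of compact objects compact. Finally, the order in the Balmer
  spectrum is reversed compared with commutative rings: the closure of \<open>P\<close> consists of
  the primes contained in \<open>P\<close>, so the support of \<open>x\<close> is controlled by
  showing \<open>Q \<subseteq> P\<close> for each \<open>Q\<close> in it.\<close>

notation plus_arrow (infixl "\<oplus>\<index>" 65)

section \<open>Additive categories\<close>

text \<open>Unfolding membership into equations on \<open>src\<close> and \<open>tgt\<close> lets
  the simplifier discharge typing conditions; later statements therefore carry such equations
  instead of hom-sets.\<close>

lemma Hom_iff [simp]: "f \<in> Hom C X Y \<longleftrightarrow> src C f = X \<and> tgt C f = Y"
  by (simp add: Hom_def)

context category
begin

lemma src_ident [simp]: "src C (ident C X) = X" and tgt_ident [simp]: "tgt C (ident C X) = X"
  using ident_in_Hom[of X] by auto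

lemma src_cmp [simp]: "tgt C f = src C g \<Longrightarrow> src C (g \<cdot> f) = src C f"
  and tgt_cmp [simp]: "tgt C f = src C g \<Longrightarrow> tgt C (g \<cdot> f) = tgt C g"
  using cmp_in_Hom[of f "src C f" "tgt C f" g "tgt C g"] by auto

lemma cmp_id_left [simp]: "tgt C f = Y \<Longrightarrow> ident C Y \<cdot> f = f"
  using cmp_ident_left[of f "src C f" Y] by auto

lemma cmp_id_right [simp]: "src C f = X \<Longrightarrow> f \<cdot> ident C X = f"
  using cmp_ident_right[of f X "tgt C f"] by auto

lemma assoc: "\<lbrakk>tgt C f = src C g; tgt C g = src C h\<rbrakk> \<Longrightarrow> (h \<cdot> g) \<cdot> f = h \<cdot> (g \<cdot> f)"
  using cmp_assoc[of f "src C f" "tgt C f" g "tgt C g" h "tgt C h"] by auto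

text \<open>Composites are kept nested to the right, where the left side of a known equation no
  longer occurs as a subterm; this form rewrites it in front of a further factor
  \<open>k\<close>.\<close>

lemma assoc_red: "\<lbrakk>g \<cdot> f = h; tgt C f = src C g; tgt C k = src C f\<rbrakk> \<Longrightarrow> g \<cdot> (f \<cdot> k) = h \<cdot> k"
  using assoc by metis

lemma iso_arrowE:
  assumes "iso_arrow C f"
  obtains g where "src C g = tgt C f" "tgt C g = src C f"
    "g \<cdot> f = ident C (src C f)" "f \<cdot> g = ident C (tgt C f)"
  using assms by (auto simp: iso_arrow_def inverse_arrows_def)

lemma iso_arrowI:
  "\<lbrakk>src C g = tgt C f; tgt C g = src C f; g \<cdot> f = ident C (src C f); f \<cdot> g = ident C (tgt C f)\<rbrakk>
    \<Longrightarrow> iso_arrow C f"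
  by (auto simp: iso_arrow_def inverse_arrows_def)

lemma isomorphicI:
  "\<lbrakk>src C f = X; tgt C f = Y; src C g = Y; tgt C g = X; g \<cdot> f = ident C X; f \<cdot> g = ident C Y\<rbrakk>
    \<Longrightarrow> isomorphic C X Y"
  unfolding isomorphic_def by (rule bexI[of _ f]) (auto intro: iso_arrowI)

lemma isomorphicE:
  assumes "isomorphic C X Y"
  obtains f g where "src C f = X" "tgt C f = Y" "src C g = Y" "tgt C g = X"
    "g \<cdot> f = ident C X" "f \<cdot> g = ident C Y"
proof -
  from assms obtain f where f: "src C f = X" "tgt C f = Y" "iso_arrow C f"
    by (auto simp: isomorphic_def)
  from f(3) obtain g where "src C g = tgt C f" "tgt C g = src C f"
    "g \<cdot> f = ident C (src C f)" "f \<cdot> g = ident C (tgt C f)"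
    by (rule iso_arrowE)
  with f show thesis by (intro that) simp_all
qed

lemma isomorphic_iso_arrow: "iso_arrow C f \<Longrightarrow> isomorphic C (src C f) (tgt C f)"
  by (auto simp: isomorphic_def)

lemma isomorphic_refl: "isomorphic C X X"
  by (rule isomorphicI[of "ident C X" _ _ "ident C X"]) simp_all

lemma isomorphic_sym: "isomorphic C X Y \<Longrightarrow> isomorphic C Y X"
  by (erule isomorphicE, rule isomorphicI)

lemma isomorphic_trans:
  assumes "isomorphic C X Y" "isomorphic C Y Z"
  shows "isomorphic C X Z"
proof -
  obtain f g where 1: "src C f = X" "tgt C f = Y" "src C g = Y" "tgt C g = X"
    "g \<cdot> f = ident C X" "f \<cdot> g = ident C Y"
    using assms(1) by (rule isomorphicE)
  obtain h k where 2: "src C h = Y" "tgt C h = Z" "src C k = Z" "tgt C k = Y"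
    "k \<cdot> h = ident C Y" "h \<cdot> k = ident C Z"
    using assms(2) by (rule isomorphicE)
  show ?thesis
    by (rule isomorphicI[of "h \<cdot> f" _ _ "g \<cdot> k"])
      (simp_all add: 1 2 assoc assoc_red[OF 2(5)] assoc_red[OF 1(6)])
qed

lemma iso_cancel_left:
  assumes "k \<cdot> f = k \<cdot> g" "iso_arrow C k" "tgt C f = src C k" "tgt C g = src C k"
  shows "f = g"
proof -
  obtain k' where k': "src C k' = tgt C k" "tgt C k' = src C k" "k' \<cdot> k = ident C (src C k)"
    using assms(2) by (rule iso_arrowE)
  have "k' \<cdot> (k \<cdot> f) = k' \<cdot> (k \<cdot> g)" by (simp add: assms(1))
  then show ?thesis using assms(3,4) by (simp add: assoc_red[OF k'(3)] k')
qed

lemma iso_cancel_right: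
  assumes "f \<cdot> k = g \<cdot> k" "iso_arrow C k" "src C f = tgt C k" "src C g = tgt C k"
  shows "f = g"
proof -
  obtain k' where k': "src C k' = tgt C k" "tgt C k' = src C k" "k \<cdot> k' = ident C (tgt C k)"
    using assms(2) by (rule iso_arrowE)
  have "(f \<cdot> k) \<cdot> k' = (g \<cdot> k) \<cdot> k'" by (simp add: assms(1))
  then show ?thesis using assms(3,4) by (simp add: assoc k')
qed

section \<open>Universal property of coproducts\<close>

lemma coproduct_inj:
  "\<lbrakk>is_coproduct C I X S \<iota>; i \<in> I\<rbrakk> \<Longrightarrow> src C (\<iota> i) = X i"
  "\<lbrakk>is_coproduct C I X S \<iota>; i \<in> I\<rbrakk> \<Longrightarrow> tgt C (\<iota> i) = S"
  by (auto simp: is_coproduct_def)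

lemma coproduct_lift:
  assumes "is_coproduct C I X S \<iota>" and "\<And>i. i \<in> I \<Longrightarrow> src C (h i) = X i \<and> tgt C (h i) = Z"
  obtains k where "src C k = S" "tgt C k = Z" "\<And>i. i \<in> I \<Longrightarrow> k \<cdot> \<iota> i = h i"
proof -
  have "\<exists>!k. k \<in> Hom C S Z \<and> (\<forall>i \<in> I. k \<cdot> \<iota> i = h i)"
    using assms unfolding is_coproduct_def by simp
  then show thesis using that by auto
qed

lemma coproduct_eqI:
  assumes "is_coproduct C I X S \<iota>" "src C k = S" "src C k' = S" "tgt C k = tgt C k'"
    and "\<And>i. i \<in> I \<Longrightarrow> k \<cdot> \<iota> i = k' \<cdot> \<iota> i"
  shows "k = k'"
proof -
  have "\<forall>i \<in> I. k \<cdot> \<iota> i \<in> Hom C (X i) (tgt C k)"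
    using assms(1,2) by (auto simp: coproduct_inj)
  then have "\<exists>!m. m \<in> Hom C S (tgt C k) \<and> (\<forall>i \<in> I. m \<cdot> \<iota> i = k \<cdot> \<iota> i)"
    using conjunct2[OF assms(1)[unfolded is_coproduct_def], rule_format, of "\<lambda>i. k \<cdot> \<iota> i" "tgt C k"] by blast
  then show ?thesis using assms(2-5) by (elim ex1E) (metis Hom_iff)
qed

lemma coproductI:
  assumes "\<And>i. i \<in> I \<Longrightarrow> src C (\<iota> i) = X i" "\<And>i. i \<in> I \<Longrightarrow> tgt C (\<iota> i) = S"
    and "\<And>Z h. (\<And>i. i \<in> I \<Longrightarrow> src C (h i) = X i \<and> tgt C (h i) = Z) \<Longrightarrow>
      \<exists>k. src C k = S \<and> tgt C k = Z \<and> (\<forall>i \<in> I. k \<cdot> \<iota> i = h i)"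
    and "\<And>k k'. \<lbrakk>src C k = S; src C k' = S; tgt C k = tgt C k'; \<And>i. i \<in> I \<Longrightarrow> k \<cdot> \<iota> i = k' \<cdot> \<iota> i\<rbrakk>
      \<Longrightarrow> k = k'"
  shows "is_coproduct C I X S \<iota>"
  unfolding is_coproduct_def
proof (intro conjI allI impI)
  show "\<forall>i\<in>I. \<iota> i \<in> Hom C (X i) S" using assms(1,2) by simp
next
  fix Z h assume "\<forall>i\<in>I. h i \<in> Hom C (X i) Z"
  then obtain k where "src C k = S" "tgt C k = Z" "\<forall>i \<in> I. k \<cdot> \<iota> i = h i"
    using assms(3)[of h Z] by auto
  then show "\<exists>!k. k \<in> Hom C S Z \<and> (\<forall>i\<in>I. k \<cdot> \<iota> i = h i)"
  proof (intro ex1I[of _ k])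
    fix k' assume "k' \<in> Hom C S Z \<and> (\<forall>i\<in>I. k' \<cdot> \<iota> i = h i)"
    then show "k' = k" using \<open>src C k = S\<close> \<open>tgt C k = Z\<close> \<open>\<forall>i \<in> I. k \<cdot> \<iota> i = h i\<close>
      by (rule_tac assms(4)) simp_all
  qed simp
qed

text \<open>Small coproducts are indexed by subsets of the universe type; an injection from
  \<open>nat\<close> turns one of them into the countable coproduct that the swindle works
  with.\<close>

lemma coproduct_reindex:
  assumes "is_coproduct C (\<gamma> ` J) X S \<iota>" "inj_on \<gamma> J"
  shows "is_coproduct C J (X \<circ> \<gamma>) S (\<iota> \<circ> \<gamma>)"
proof (rule coproductI)
  fix Z h assume "\<And>j. j \<in> J \<Longrightarrow> src C (h j) = (X \<circ> \<gamma>) j \<and> tgt C (h j) = Z"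
  then have "src C ((h \<circ> inv_into J \<gamma>) i) = X i \<and> tgt C ((h \<circ> inv_into J \<gamma>) i) = Z" if "i \<in> \<gamma> ` J" for i
    using that assms(2) by auto
  then obtain k where k: "src C k = S" "tgt C k = Z" "\<And>i. i \<in> \<gamma> ` J \<Longrightarrow> k \<cdot> \<iota> i = (h \<circ> inv_into J \<gamma>) i"
    using coproduct_lift[OF assms(1), of "h \<circ> inv_into J \<gamma>" Z] by blast
  show "\<exists>k. src C k = S \<and> tgt C k = Z \<and> (\<forall>j\<in>J. k \<cdot> (\<iota> \<circ> \<gamma>) j = h j)"
    by (rule exI[of _ k]) (use k assms(2) in simp)
next
  fix k k' assume "src C k = S" "src C k' = S" "tgt C k = tgt C k'"
    "\<And>j. j \<in> J \<Longrightarrow> k \<cdot> (\<iota> \<circ> \<gamma>) j = k' \<cdot> (\<iota> \<circ> \<gamma>) j"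
  then show "k = k'" by (rule_tac coproduct_eqI[OF assms(1)]) auto
qed (use assms(1) in \<open>auto simp: coproduct_inj\<close>)

end

section \<open>Arithmetic of arrows in an additive category\<close>

context additive_category
begin

lemma carrier_hom_group [simp]: "carrier (hom_group C X Y) = Hom C X Y"
  and mult_hom_group [simp]: "monoid.mult (hom_group C X Y) = plus_arrow C"
  and one_hom_group [simp]: "one (hom_group C X Y) = zero_arrow C X Y"
  by (simp_all add: hom_group_def)

lemma src_zero [simp]: "src C (zero_arrow C X Y) = X"
  and tgt_zero [simp]: "tgt C (zero_arrow C X Y) = Y"
proof -
  interpret comm_group "hom_group C X Y" by (rule hom_comm_group)
  show "src C (zero_arrow C X Y) = X" "tgt C (zero_arrow C X Y) = Y" using one_closed by auto
qed

lemma src_plus [simp]: "\<lbrakk>src C f = src C g; tgt C f = tgt C g\<rbrakk> \<Longrightarrow> src C (f \<oplus> g) = src C g"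
  and tgt_plus [simp]: "\<lbrakk>src C f = src C g; tgt C f = tgt C g\<rbrakk> \<Longrightarrow> tgt C (f \<oplus> g) = tgt C g"
proof -
  interpret comm_group "hom_group C (src C g) (tgt C g)" by (rule hom_comm_group)
  assume "src C f = src C g" "tgt C f = tgt C g"
  then show "src C (f \<oplus> g) = src C g" "tgt C (f \<oplus> g) = tgt C g" using m_closed[of f g] by auto
qed

lemma plus_zero [simp]: "\<lbrakk>src C f = X; tgt C f = Y\<rbrakk> \<Longrightarrow> f \<oplus> zero_arrow C X Y = f"
  and zero_plus [simp]: "\<lbrakk>src C f = X; tgt C f = Y\<rbrakk> \<Longrightarrow> zero_arrow C X Y \<oplus> f = f"
proof -
  interpret comm_group "hom_group C X Y" by (rule hom_comm_group)
  assume "src C f = X" "tgt C f = Y"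
  then show "f \<oplus> zero_arrow C X Y = f" "zero_arrow C X Y \<oplus> f = f" using r_one[of f] l_one[of f] by auto
qed

lemma plus_commute: "\<lbrakk>src C f = src C g; tgt C f = tgt C g\<rbrakk> \<Longrightarrow> f \<oplus> g = g \<oplus> f"
proof -
  interpret comm_group "hom_group C (src C g) (tgt C g)" by (rule hom_comm_group)
  assume "src C f = src C g" "tgt C f = tgt C g"
  then show ?thesis using m_comm[of f g] by auto
qed

lemma plus_assoc: "\<lbrakk>src C f = src C h; tgt C f = tgt C h; src C g = src C h; tgt C g = tgt C h\<rbrakk>
  \<Longrightarrow> (f \<oplus> g) \<oplus> h = f \<oplus> (g \<oplus> h)"
proof -
  interpret comm_group "hom_group C (src C h) (tgt C h)" by (rule hom_comm_group)
  assume "src C f = src C h" "tgt C f = tgt C h" "src C g = src C h" "tgt C g = tgt C h"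
  then show ?thesis using m_assoc[of f g h] by auto
qed

lemma src_neg [simp]: "src C (neg_arrow C f) = src C f"
  and tgt_neg [simp]: "tgt C (neg_arrow C f) = tgt C f"
  and plus_neg [simp]: "f \<oplus> neg_arrow C f = zero_arrow C (src C f) (tgt C f)"
  and neg_plus [simp]: "neg_arrow C f \<oplus> f = zero_arrow C (src C f) (tgt C f)"
proof -
  interpret comm_group "hom_group C (src C f) (tgt C f)" by (rule hom_comm_group)
  show "src C (neg_arrow C f) = src C f" "tgt C (neg_arrow C f) = tgt C f"
    "f \<oplus> neg_arrow C f = zero_arrow C (src C f) (tgt C f)"
    "neg_arrow C f \<oplus> f = zero_arrow C (src C f) (tgt C f)"
    using inv_closed[of f] r_inv[of f] l_inv[of f] by (auto simp: neg_arrow_def)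
qed

lemma plus_left_cancel:
  assumes "src C f = src C h" "tgt C f = tgt C h" "src C g = src C h" "tgt C g = tgt C h"
  shows "f \<oplus> g = f \<oplus> h \<longleftrightarrow> g = h"
proof -
  interpret comm_group "hom_group C (src C h) (tgt C h)" by (rule hom_comm_group)
  show ?thesis using assms Units_l_cancel[of f g h] by (simp add: Units_eq)
qed

text \<open>A group has only one idempotent. This is how preservation of zero is deduced from
  additivity of composition, of the suspension and of the tensor product.\<close>

lemma plus_self_zero: "f \<oplus> f = f \<Longrightarrow> f = zero_arrow C (src C f) (tgt C f)"
  using plus_left_cancel[of f "zero_arrow C (src C f) (tgt C f)" f] by simp

lemma plus_cmp: "\<lbrakk>tgt C f = src C g; src C g = src C g'; tgt C g = tgt C g'\<rbrakk> \<Longrightarrow>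
    (g \<oplus> g') \<cdot> f = g \<cdot> f \<oplus> g' \<cdot> f"
  by (rule cmp_plus_left[of _ "src C f" "tgt C f" _ "tgt C g"]) auto

lemma cmp_plus: "\<lbrakk>tgt C f = src C g; src C f = src C f'; tgt C f = tgt C f'\<rbrakk> \<Longrightarrow>
    g \<cdot> (f \<oplus> f') = g \<cdot> f \<oplus> g \<cdot> f'"
  by (rule cmp_plus_right[of _ "src C f" "tgt C f" _ _ "tgt C g"]) auto

lemma zero_cmp [simp]: "tgt C f = Y \<Longrightarrow> zero_arrow C Y Z \<cdot> f = zero_arrow C (src C f) Z"
  using plus_self_zero[of "zero_arrow C Y Z \<cdot> f"] plus_cmp[of f "zero_arrow C Y Z" "zero_arrow C Y Z"]
  by simp

lemma cmp_zero [simp]: "src C g = Y \<Longrightarrow> g \<cdot> zero_arrow C X Y = zero_arrow C X (tgt C g)"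
  using plus_self_zero[of "g \<cdot> zero_arrow C X Y"] cmp_plus[of "zero_arrow C X Y" g "zero_arrow C X Y"]
  by simp

lemma neg_unique:
  assumes "f \<oplus> g = zero_arrow C (src C f) (tgt C f)" "src C f = src C g" "tgt C f = tgt C g"
  shows "g = neg_arrow C f"
  using assms plus_left_cancel[of f g "neg_arrow C f"] by simp

lemma cmp_neg: "tgt C f = src C g \<Longrightarrow> g \<cdot> neg_arrow C f = neg_arrow C (g \<cdot> f)"
  by (rule neg_unique) (simp_all flip: cmp_plus)

lemma neg_cmp: "tgt C f = src C g \<Longrightarrow> neg_arrow C g \<cdot> f = neg_arrow C (g \<cdot> f)"
  by (rule neg_unique) (simp_all flip: plus_cmp)

lemma neg_zero [simp]: "neg_arrow C (zero_arrow C X Y) = zero_arrow C X Y"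
  by (rule neg_unique[symmetric]) simp_all

lemma neg_eq_zero: "neg_arrow C f = zero_arrow C X Y \<Longrightarrow> f = zero_arrow C X Y"
  by (metis plus_neg plus_zero src_neg src_zero tgt_neg tgt_zero)

lemma eq_if_diff_zero:
  assumes "f \<oplus> neg_arrow C g = zero_arrow C X Y" "src C f = src C g" "tgt C f = tgt C g"
  shows "f = g"
proof -
  have "X = src C f" "Y = tgt C f" 
    using assms by (metis src_plus src_zero src_neg tgt_neg, metis tgt_plus tgt_zero src_neg tgt_neg)
  then have "(f \<oplus> neg_arrow C g) \<oplus> g = g" using assms by simp
  then show ?thesis using assms(2,3) by (simp add: plus_assoc)
qed

lemma is_zero_from: "\<lbrakk>is_zero C X; src C f = X\<rbrakk> \<Longrightarrow> f = zero_arrow C X (tgt C f)"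
  by (metis cmp_id_right cmp_zero is_zero_def)

lemma biproduct_retract:
  assumes "is_biproduct C B X Y" "Z = X \<or> Z = Y"
  obtains i p where "src C i = Z" "tgt C i = B" "src C p = B" "tgt C p = Z" "p \<cdot> i = ident C Z"
  using assms unfolding is_biproduct_def Bex_def Hom_iff by blast

text \<open>Zero arrows turn the Kronecker delta into a cocone, so a coproduct has coordinate
  projections although it need not be a product. They recover the coefficients of a finite
  sum.\<close>

lemma coproduct_proj:
  assumes "is_coproduct C I X S \<iota>"
  obtains \<pi> where "\<And>i. i \<in> I \<Longrightarrow> src C (\<pi> i) = S" "\<And>i. i \<in> I \<Longrightarrow> tgt C (\<pi> i) = X i"
    "\<And>i j. \<lbrakk>i \<in> I; j \<in> I\<rbrakk> \<Longrightarrow> \<pi> i \<cdot> \<iota> j = (if i = j then ident C (X i) else zero_arrow C (X j) (X i))"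
proof -
  have "\<exists>p. src C p = S \<and> tgt C p = X i \<and>
      (\<forall>j \<in> I. p \<cdot> \<iota> j = (if i = j then ident C (X i) else zero_arrow C (X j) (X i)))" for i
    by (rule coproduct_lift[OF assms, of "\<lambda>j. if i = j then ident C (X i) else zero_arrow C (X j) (X i)" "X i"])
      auto
  then obtain \<pi> where "\<And>i. src C (\<pi> i) = S \<and> tgt C (\<pi> i) = X i \<and>
      (\<forall>j \<in> I. \<pi> i \<cdot> \<iota> j = (if i = j then ident C (X i) else zero_arrow C (X j) (X i)))"
    by metis
  then show thesis by (intro that[of \<pi>]) auto
qed

end

section \<open>Triangulated subcategories\<close>

context triangulated_category
begin

lemma src_susp [simp]: "src T (susp_arrow T f) = susp T (src T f)"
  and tgt_susp [simp]: "tgt T (susp_arrow T f) = susp T (tgt T f)"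
  using susp_in_Hom[of f "src T f" "tgt T f"] by auto

lemma susp_arrow_cmp: "tgt T f = src T g \<Longrightarrow> susp_arrow T (g \<cdot> f) = susp_arrow T g \<cdot> susp_arrow T f"
  by (rule susp_cmp[of _ "src T f" "tgt T f" _ "tgt T g"]) simp_all

lemma susp_arrow_plus: "\<lbrakk>src T f = src T g; tgt T f = tgt T g\<rbrakk> \<Longrightarrow>
    susp_arrow T (f \<oplus> g) = susp_arrow T f \<oplus> susp_arrow T g"
  by (rule susp_plus[of _ "src T f" "tgt T f"]) simp_all

lemma susp_zero [simp]: "susp_arrow T (zero_arrow T X Y) = zero_arrow T (susp T X) (susp T Y)"
proof -
  let ?z = "susp_arrow T (zero_arrow T X Y)"
  have "?z \<oplus> ?z = ?z" by (simp flip: susp_arrow_plus)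
  then show ?thesis using plus_self_zero by fastforce
qed

lemma susp_arrow_inj:
  assumes "susp_arrow T f = susp_arrow T g" "src T f = src T g" "tgt T f = tgt T g"
  shows "f = g"
  using susp_fully_faithful[of "src T g" "tgt T g"] assms
  by (auto simp: bij_betw_def dest: inj_onD)

lemma susp_arrow_full:
  assumes "src T k = susp T X" "tgt T k = susp T Y"
  obtains f where "src T f = X" "tgt T f = Y" "susp_arrow T f = k"
proof -
  have "k \<in> susp_arrow T ` Hom T X Y"
    using susp_fully_faithful[of X Y] assms by (auto simp: bij_betw_def)
  then show thesis using that by auto
qed

lemma is_zero_susp: "is_zero T X \<Longrightarrow> is_zero T (susp T X)"
  by (metis is_zero_def susp_ident susp_zero)

lemma dist_typing:
  assumes "dist T f g h"
  shows "src T g = tgt T f" "src T h = tgt T g" "tgt T h = susp T (src T f)"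
  using dist_arrows[OF assms] by auto

lemma dist_rotate_iff:
  "\<lbrakk>src T g = tgt T f; src T h = tgt T g; tgt T h = susp T (src T f)\<rbrakk> \<Longrightarrow>
    dist T f g h \<longleftrightarrow> dist T g h (neg_arrow T (susp_arrow T f))"
  by (rule dist_rotate[of _ "src T f" "tgt T f" _ "tgt T g"]) auto

lemma dist_rot: "dist T f g h \<Longrightarrow> dist T g h (neg_arrow T (susp_arrow T f))"
  using dist_rotate_iff dist_typing by blast

lemma dist_extend:
  assumes "dist T f g h" "dist T f' g' h'" "v \<cdot> f = f' \<cdot> u"
    and "src T u = src T f" "tgt T u = src T f'" "src T v = tgt T f" "tgt T v = tgt T f'"
  obtains w where "src T w = tgt T g" "tgt T w = tgt T g'" "w \<cdot> g = g' \<cdot> v"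
proof -
  have "\<exists>w \<in> Hom T (tgt T g) (tgt T g'). w \<cdot> g = g' \<cdot> v \<and> susp_arrow T u \<cdot> h = h' \<cdot> w"
    by (rule dist_morphism[OF assms(1) _ _ assms(2)]) (use assms dist_typing in auto)
  then show thesis using that by auto
qed

text \<open>Mapping the triangle \<open>X = X \<rightarrow> 0\<close> to the given one, by the
  identity and \<open>f\<close>, makes the composite factor through a zero object.\<close>

lemma dist_cmp_zero:
  assumes "dist T f g h"
  shows "g \<cdot> f = zero_arrow T (src T f) (tgt T g)"
proof -
  note [simp] = dist_typing[OF assms]
  obtain Z where Z: "is_zero T Z" using ex_zero_object by blast
  obtain w where w: "src T w = Z" "tgt T w = tgt T g" "w \<cdot> zero_arrow T (src T f) Z = g \<cdot> f"
    by (rule dist_extend[OF dist_ident[OF Z, of "src T f"] assms, of f "ident T (src T f)"]) simp_all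
  then show ?thesis by simp
qed

text \<open>A map \<open>k\<close> killing \<open>f\<close> gives a morphism to the triangle
  \<open>0 \<rightarrow> W = W\<close>, whose third component is the extension of \<open>k\<close>
  along \<open>g\<close>. That triangle is an identity triangle rotated backwards, which is why
  \<open>\<Sigma>0\<close> appears.\<close>

lemma dist_weak_cokernel:
  assumes "dist T f g h" "src T k = tgt T f" "k \<cdot> f = zero_arrow T (src T f) (tgt T k)"
  obtains k' where "src T k' = tgt T g" "tgt T k' = tgt T k" "k' \<cdot> g = k"
proof -
  note [simp] = dist_typing[OF assms(1)]
  obtain Z where Z: "is_zero T Z" using ex_zero_object by blast
  let ?W = "tgt T k"
  have "dist T (ident T ?W) (zero_arrow T ?W (susp T Z)) (zero_arrow T (susp T Z) (susp T ?W))"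
    using dist_ident Z is_zero_susp by blast
  then have *: "dist T (zero_arrow T Z ?W) (ident T ?W) (zero_arrow T ?W (susp T Z))"
    by (subst dist_rotate_iff) simp_all
  obtain w where "src T w = tgt T g" "tgt T w = ?W" "w \<cdot> g = ident T ?W \<cdot> k"
    by (rule dist_extend[OF assms(1) *, of k "zero_arrow T (src T f) Z"]) (simp_all add: assms)
  then show thesis by (intro that) simp_all
qed

section \<open>Triangulated and localizing subcategories, and their closure under summands\<close>

lemma triangulated_subcategoryD:
  assumes "triangulated_subcategory T L"
  shows "is_zero T X \<Longrightarrow> X \<in> L" "\<lbrakk>isomorphic T X Y; X \<in> L\<rbrakk> \<Longrightarrow> Y \<in> L"
    "susp T X \<in> L \<longleftrightarrow> X \<in> L"
    "\<lbrakk>dist T f g h; src T f \<in> L; tgt T f \<in> L\<rbrakk> \<Longrightarrow> tgt T g \<in> L"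
  using assms unfolding triangulated_subcategory_def by blast+

lemma triangulated_Int:
  "\<lbrakk>triangulated_subcategory T K; triangulated_subcategory T L\<rbrakk> \<Longrightarrow> triangulated_subcategory T (K \<inter> L)"
  unfolding triangulated_subcategory_def by blast

text \<open>The definition provides cones only. Rotating twice exhibits the suspension of the middle
  term as the cone of \<open>h\<close>.\<close>

lemma triangulated_subcategory_middle:
  assumes "triangulated_subcategory T L" "dist T f g h" "src T f \<in> L" "tgt T g \<in> L"
  shows "tgt T f \<in> L"
proof -
  note [simp] = dist_typing[OF assms(2)]
  have "dist T h (neg_arrow T (susp_arrow T f)) (neg_arrow T (susp_arrow T g))"
    using assms(2) by (intro dist_rot)
  from triangulated_subcategoryD(4)[OF assms(1) this] show ?thesis
    using assms triangulated_subcategoryD(3)[OF assms(1)] by simp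
qed

text \<open>The cone of the split monomorphism \<open>i\<close> is isomorphic to the complementary summand.\<close>

lemma triangulated_subcategory_complement:
  assumes L: "triangulated_subcategory T L" "A \<in> L" "B \<in> L"
    and typing [simp]: "src T i = A" "tgt T i = B" "src T p = B" "tgt T p = A"
      "src T j = X" "tgt T j = B" "src T q = B" "tgt T q = X"
    and bi: "p \<cdot> i = ident T A" "q \<cdot> j = ident T X" "q \<cdot> i = zero_arrow T A X"
      "i \<cdot> p \<oplus> j \<cdot> q = ident T B"
  shows "X \<in> L"
proof -
  obtain g h where d: "dist T i g h" using ex_dist by blast
  note [simp] = dist_typing[OF d, simplified]
  let ?Y = "tgt T g"
  \<comment> \<open>Two rotations give \<open>\<Sigma>i \<cdot> h = 0\<close>; since
    \<open>\<Sigma>p\<close> is a left inverse of \<open>\<Sigma>i\<close>, the connecting map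
    \<open>h\<close> vanishes.\<close>
  have "neg_arrow T (susp_arrow T i) \<cdot> h = zero_arrow T ?Y (susp T B)"
    using dist_cmp_zero[OF dist_rot[OF dist_rot[OF d]]] by simp
  then have "susp_arrow T i \<cdot> h = zero_arrow T ?Y (susp T B)"
    by (simp add: neg_cmp neg_eq_zero)
  then have "(susp_arrow T p \<cdot> susp_arrow T i) \<cdot> h = zero_arrow T ?Y (susp T A)"
    by (simp add: assoc)
  then have h: "h = zero_arrow T ?Y (susp T A)"
    by (simp add: bi susp_ident flip: susp_arrow_cmp)
  obtain q' where q': "src T q' = ?Y" "tgt T q' = X" "q' \<cdot> g = q"
    by (rule dist_weak_cokernel[OF d, of q]) (simp_all add: bi)
  have gi: "g \<cdot> i = zero_arrow T A ?Y" using dist_cmp_zero[OF d] by simp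
  have 1: "q' \<cdot> (g \<cdot> j) = ident T X"
    by (simp add: assoc_red[OF q'(3)] q' bi)
  have "g = g \<cdot> (i \<cdot> p \<oplus> j \<cdot> q)" by (simp add: bi)
  also have "\<dots> = g \<cdot> (j \<cdot> q)" by (simp add: cmp_plus assoc_red[OF gi])
  finally have gjq: "g \<cdot> (j \<cdot> q) = g" by simp
  \<comment> \<open>\<open>?k\<close> is the defect of \<open>g \<cdot> j\<close> and
    \<open>q'\<close> from being inverse on \<open>?Y\<close>. It kills \<open>g\<close>, hence
    factors through \<open>h = 0\<close>.\<close>
  let ?k = "(g \<cdot> j) \<cdot> q' \<oplus> neg_arrow T (ident T ?Y)"
  have "?k \<cdot> g = zero_arrow T B ?Y"
    by (simp add: plus_cmp neg_cmp assoc q' gjq)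
  then obtain m where m: "src T m = susp T A" "tgt T m = ?Y" "m \<cdot> h = ?k"
    by (rule_tac dist_weak_cokernel[OF dist_rot[OF d], of ?k]) (simp_all add: q')
  then have "?k = zero_arrow T ?Y ?Y" using h by simp
  then have 2: "(g \<cdot> j) \<cdot> q' = ident T ?Y" by (rule eq_if_diff_zero) (simp_all add: q')
  have "isomorphic T ?Y X"
    by (rule isomorphicI[of q' _ _ "g \<cdot> j"]) (simp_all add: q' 1 2)
  moreover have "?Y \<in> L" using triangulated_subcategoryD(4)[OF L(1) d] L by simp
  ultimately show ?thesis using triangulated_subcategoryD(2)[OF L(1)] by blast
qed

lemma localizing_triangulated: "localizing U T L \<Longrightarrow> triangulated_subcategory T L"
  by (simp add: localizing_def)

lemma localizing_coproduct:
  "\<lbrakk>localizing U T L; is_coproduct T (I :: 'u set) X S \<iota>; small U I; \<And>i. i \<in> I \<Longrightarrow> X i \<in> L\<rbrakk> \<Longrightarrow> S \<in> L"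
  for U :: "'u itself"
  unfolding localizing_def by blast

text \<open>
  An Eilenberg swindle: with \<open>\<epsilon> = i \<cdot> p\<close>, the map \<open>\<phi>\<close> on \<open>\<Coprod>\<^sub>n B\<close> that shifts the image of \<open>\<epsilon>\<close> and
  fixes its complement is a split monomorphism with complement \<open>X\<close>.
\<close>

lemma localizing_retract:
  fixes U :: "'u itself"
  assumes inf: "natLeq <o |UNIV :: 'u set|" and cop: "has_small_coproducts U T"
    and L: "localizing U T L" "B \<in> L"
    and [simp]: "src T i = X" "tgt T i = B" "src T p = B" "tgt T p = X"
    and pi: "p \<cdot> i = ident T X"
  shows "X \<in> L"
proof -
  \<comment> \<open>The strict inequality does two jobs: \<open>nat\<close> embeds into
    \<open>'u\<close>, and the image is small, so the countable coproduct exists.\<close>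
  have "|UNIV :: nat set| \<le>o |UNIV :: 'u set|"
    using inf card_of_nat ordIso_ordLeq_trans ordLess_imp_ordLeq by blast
  then obtain \<gamma> :: "nat \<Rightarrow> 'u" where \<gamma>: "inj \<gamma>" by (auto simp flip: card_of_ordLeq)
  have "|range \<gamma>| \<le>o |UNIV :: nat set|" by (rule card_of_image)
  then have "|range \<gamma>| \<le>o natLeq" using card_of_nat ordLeq_ordIso_trans by blast
  then have small: "small U (range \<gamma>)"
    using inf ordLeq_ordLess_trans unfolding small_def by blast
  then obtain S \<iota>' where S': "is_coproduct T (range \<gamma>) (\<lambda>_. B) S \<iota>'"
    using cop unfolding has_small_coproducts_def by blast
  then have SL: "S \<in> L" using localizing_coproduct[OF L(1) _ small] L(2) by blast
  define \<iota> where "\<iota> = \<iota>' \<circ> \<gamma>"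
  have S: "is_coproduct T UNIV (\<lambda>_. B) S \<iota>"
    using coproduct_reindex[OF S' \<gamma>] by (simp add: \<iota>_def comp_def)
  have [simp]: "src T (\<iota> n) = B" "tgt T (\<iota> n) = S" for n
    using coproduct_inj[OF S] by auto
  \<comment> \<open>\<open>\<epsilon>\<close> is the idempotent that splits through
    \<open>X\<close>. Its complement \<open>c\<close> is handled as an arrow because no object
    splitting it is given.\<close>
  define \<epsilon> where "\<epsilon> = i \<cdot> p"
  define c where "c = ident T B \<oplus> neg_arrow T \<epsilon>"
  have [simp]: "src T \<epsilon> = B" "tgt T \<epsilon> = B" "src T c = B" "tgt T c = B"
    by (simp_all add: c_def \<epsilon>_def)
  have p\<epsilon>: "p \<cdot> \<epsilon> = p" and \<epsilon>i: "\<epsilon> \<cdot> i = i"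
    by (simp_all add: \<epsilon>_def assoc pi assoc_red[OF pi])
  have \<epsilon>\<epsilon>: "\<epsilon> \<cdot> \<epsilon> = \<epsilon>" by (simp add: \<epsilon>_def assoc assoc_red[OF pi])
  have pc: "p \<cdot> c = zero_arrow T B X" by (simp add: c_def cmp_plus cmp_neg p\<epsilon>)
  have \<epsilon>c: "\<epsilon> \<cdot> c = zero_arrow T B B" by (simp add: c_def cmp_plus cmp_neg \<epsilon>\<epsilon>)
  have c\<epsilon>: "c \<cdot> \<epsilon> = zero_arrow T B B" by (simp add: c_def plus_cmp neg_cmp \<epsilon>\<epsilon>)
  have cc: "c \<cdot> c = c" using \<epsilon>c
    by (subst c_def) (simp add: plus_cmp neg_cmp)
  have \<epsilon>_c: "\<epsilon> \<oplus> c = ident T B"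
    by (simp add: c_def plus_commute[of "ident T B"] flip: plus_assoc)
  have \<iota>_split: "\<iota> n \<cdot> \<epsilon> \<oplus> \<iota> n \<cdot> c = \<iota> n" for n
    by (simp add: \<epsilon>_c flip: cmp_plus)
  note split = \<epsilon>\<epsilon> \<epsilon>c c\<epsilon> cc
  obtain \<phi> where [simp]: "src T \<phi> = S" "tgt T \<phi> = S"
    and \<phi>: "\<And>n. \<phi> \<cdot> \<iota> n = \<iota> (Suc n) \<cdot> \<epsilon> \<oplus> \<iota> n \<cdot> c"
    by (rule coproduct_lift[OF S, of "\<lambda>n. \<iota> (Suc n) \<cdot> \<epsilon> \<oplus> \<iota> n \<cdot> c" S]) auto
  \<comment> \<open>\<open>r\<close> shifts back down and discards the
    \<open>\<epsilon>\<close>-part of copy \<open>0\<close>, which \<open>\<phi>\<close> never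
    reaches; \<open>q\<close> below reads off that missing part, a copy of \<open>X\<close>.\<close>
  obtain r where [simp]: "src T r = S" "tgt T r = S"
    and r: "\<And>n. r \<cdot> \<iota> n = (case n of 0 \<Rightarrow> \<iota> 0 \<cdot> c | Suc m \<Rightarrow> \<iota> m \<cdot> \<epsilon> \<oplus> \<iota> n \<cdot> c)"
    by (rule coproduct_lift[OF S, of "\<lambda>n. case n of 0 \<Rightarrow> \<iota> 0 \<cdot> c | Suc m \<Rightarrow> \<iota> m \<cdot> \<epsilon> \<oplus> \<iota> n \<cdot> c" S])
      (auto split: nat.split)
  obtain q where [simp]: "src T q = S" "tgt T q = X"
    and q: "\<And>n. q \<cdot> \<iota> n = (if n = 0 then p else zero_arrow T B X)"
    by (rule coproduct_lift[OF S, of "\<lambda>n. if n = 0 then p else zero_arrow T B X" X]) auto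
  note red = assoc assoc_red[OF \<phi>] assoc_red[OF r] assoc_red[OF q] plus_cmp cmp_plus split \<phi> r q
  have "(r \<cdot> \<phi>) \<cdot> \<iota> n = \<iota> n" for n
    by (cases n) (simp_all add: red \<iota>_split)
  then have "r \<cdot> \<phi> = ident T S" by (rule_tac coproduct_eqI[OF S]) simp_all
  moreover have "(q \<cdot> \<phi>) \<cdot> \<iota> n = zero_arrow T B X" for n
    by (cases n) (simp_all add: red pc)
  then have "q \<cdot> \<phi> = zero_arrow T S X" by (rule_tac coproduct_eqI[OF S]) simp_all
  moreover have "(\<phi> \<cdot> r \<oplus> (\<iota> 0 \<cdot> i) \<cdot> q) \<cdot> \<iota> n = \<iota> n" for n
  proof (cases n)
    case 0
    have "\<iota> 0 \<cdot> (i \<cdot> p) = \<iota> 0 \<cdot> \<epsilon>" by (simp add: \<epsilon>_def)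
    then show ?thesis using \<iota>_split[of 0] by (simp add: 0 red plus_commute[of "\<iota> 0 \<cdot> c"])
  next
    case (Suc m)
    then show ?thesis using \<iota>_split[of n] by (simp add: red)
  qed
  then have "\<phi> \<cdot> r \<oplus> (\<iota> 0 \<cdot> i) \<cdot> q = ident T S" by (rule_tac coproduct_eqI[OF S]) simp_all
  moreover have "q \<cdot> (\<iota> 0 \<cdot> i) = ident T X" by (simp add: red pi)
  ultimately show ?thesis
    by (intro triangulated_subcategory_complement[OF localizing_triangulated[OF L(1)] SL SL,
          of \<phi> r "\<iota> 0 \<cdot> i" X q]) simp_all
qed

end

section \<open>Compact objects\<close>

text \<open>For a coproduct this is the image of the canonical map from the direct sum of the groups
  \<open>Hom(c, X i)\<close>. Generating it inductively lets compactness be transported by rule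
  induction, with no finite supports to follow.\<close>

inductive_set finsums ::
  "('o, 'a, 'm) add_cat_scheme \<Rightarrow> 'i set \<Rightarrow> ('i \<Rightarrow> 'a) \<Rightarrow> 'o \<Rightarrow> 'o \<Rightarrow> 'a set"
  for C I \<iota> c S where
  finsums_zero: "zero_arrow C c S \<in> finsums C I \<iota> c S"
| finsums_inj: "\<lbrakk>i \<in> I; src C \<phi> = c; tgt C \<phi> = src C (\<iota> i)\<rbrakk> \<Longrightarrow> cmp C (\<iota> i) \<phi> \<in> finsums C I \<iota> c S"
| finsums_plus: "\<lbrakk>f \<in> finsums C I \<iota> c S; g \<in> finsums C I \<iota> c S\<rbrakk> \<Longrightarrow>
    plus_arrow C f g \<in> finsums C I \<iota> c S"

context additive_category
begin

lemma finsums_typing: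
  assumes "is_coproduct C I X S \<iota>" "f \<in> finsums C I \<iota> c S"
  shows "src C f = c" "tgt C f = S"
proof -
  have "src C f = c \<and> tgt C f = S"
    using assms(2) by induction (simp_all add: coproduct_inj[OF assms(1)])
  then show "src C f = c" "tgt C f = S" by simp_all
qed

lemma cmp_finprod:
  assumes "finite F" "src C k = S" "\<And>i. i \<in> F \<Longrightarrow> src C (x i) = c \<and> tgt C (x i) = S"
  shows "k \<cdot> finprod (hom_group C c S) x F = finprod (hom_group C c (tgt C k)) (\<lambda>i. k \<cdot> x i) F"
proof -
  interpret A: comm_group "hom_group C c S" by (rule hom_comm_group)
  interpret B: comm_group "hom_group C c (tgt C k)" by (rule hom_comm_group)
  show ?thesis using assms(1,3)
  proof induction
    case empty
    then show ?case by (simp add: assms(2))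
  next
    case (insert i F)
    have "finprod (hom_group C c S) x F \<in> Hom C c S"
      using insert.prems A.finprod_closed[of x F] by auto
    with insert assms(2) show ?case
      by (subst A.finprod_insert, simp, simp, force, force,
          subst B.finprod_insert, simp, simp, force, force, simp add: cmp_plus)
  qed
qed

lemma finprod_cmp:
  assumes "finite F" "tgt C k = c" "\<And>i. i \<in> F \<Longrightarrow> src C (x i) = c \<and> tgt C (x i) = S"
  shows "finprod (hom_group C c S) x F \<cdot> k = finprod (hom_group C (src C k) S) (\<lambda>i. x i \<cdot> k) F"
proof -
  interpret A: comm_group "hom_group C c S" by (rule hom_comm_group)
  interpret B: comm_group "hom_group C (src C k) S" by (rule hom_comm_group)
  show ?thesis using assms(1,3)
  proof induction
    case empty
    then show ?case by (simp add: assms(2))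
  next
    case (insert i F)
    have "finprod (hom_group C c S) x F \<in> Hom C c S"
      using insert.prems A.finprod_closed[of x F] by auto
    with insert assms(2) show ?case
      by (subst A.finprod_insert, simp, simp, force, force,
          subst B.finprod_insert, simp, simp, force, force, simp add: plus_cmp)
  qed
qed

lemma finprod_in_finsums:
  assumes "finite F" "F \<subseteq> I" "\<And>i. i \<in> F \<Longrightarrow> src C (\<phi> i) = c \<and> tgt C (\<phi> i) = src C (\<iota> i) \<and> tgt C (\<iota> i) = S"
  shows "finprod (hom_group C c S) (\<lambda>i. \<iota> i \<cdot> \<phi> i) F \<in> finsums C I \<iota> c S"
proof -
  interpret A: comm_group "hom_group C c S" by (rule hom_comm_group)
  show ?thesis using assms
  proof induction
    case empty
    then show ?case by (simp add: finsums_zero)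
  next
    case (insert i F)
    then show ?case
      by (subst A.finprod_insert, simp, simp, force, force)
        (auto intro!: finsums_plus finsums_inj)
  qed
qed

lemma proj_finprod:
  assumes S: "is_coproduct C I X S \<iota>"
    and \<pi>: "src C \<pi> = S" "tgt C \<pi> = X j"
      "\<And>i. i \<in> I \<Longrightarrow> \<pi> \<cdot> \<iota> i = (if j = i then ident C (X j) else zero_arrow C (X i) (X j))"
    and \<phi>: "\<And>i. i \<in> I \<Longrightarrow> src C (\<phi> i) = c \<and> tgt C (\<phi> i) = X i"
    and F: "finite F" "F \<subseteq> I" "j \<in> F"
  shows "\<pi> \<cdot> finprod (hom_group C c S) (\<lambda>i. \<iota> i \<cdot> \<phi> i) F = \<phi> j"
proof -
  interpret B: comm_group "hom_group C c (X j)" by (rule hom_comm_group)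
  have "\<pi> \<cdot> finprod (hom_group C c S) (\<lambda>i. \<iota> i \<cdot> \<phi> i) F =
      finprod (hom_group C c (X j)) (\<lambda>i. \<pi> \<cdot> (\<iota> i \<cdot> \<phi> i)) F"
    unfolding \<pi>(2)[symmetric]
    by (rule cmp_finprod) (use F \<pi>(1) \<phi> coproduct_inj[OF S] in \<open>auto simp: subset_iff\<close>)
  also have "\<dots> = finprod (hom_group C c (X j)) (\<lambda>i. if j = i then \<phi> j else \<one>\<^bsub>hom_group C c (X j)\<^esub>) F"
    by (rule B.finprod_cong')
      (use F \<phi> \<pi> coproduct_inj[OF S] in \<open>auto simp: subset_iff assoc_red[OF \<pi>(3)]\<close>)
  also have "\<dots> = \<phi> j"
    using B.finprod_singleton[of j F "\<lambda>_. \<phi> j"] F \<phi>[of j] by auto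
  finally show ?thesis .
qed

text \<open>\<open>F\<close> only has to contain the support of the coefficients. This freedom
  allows two sums to be rewritten over the common index set \<open>F \<union> G\<close> and added
  termwise.\<close>

lemma finsums_decompose:
  assumes S: "is_coproduct C I X S \<iota>"
    and "f \<in> finsums C I \<iota> c S"
  shows "\<exists>\<phi> F. (\<forall>i \<in> I. src C (\<phi> i) = c \<and> tgt C (\<phi> i) = X i) \<and> finite F \<and> F \<subseteq> I \<and>
    (\<forall>i \<in> I - F. \<phi> i = zero_arrow C c (X i)) \<and>
    f = finprod (hom_group C c S) (\<lambda>i. \<iota> i \<cdot> \<phi> i) F"
proof -
  interpret A: comm_group "hom_group C c S" by (rule hom_comm_group)
  note [simp] = coproduct_inj[OF S]
  show ?thesis using assms(2)
  proof induction
    case finsums_zero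
    then show ?case
      by (intro exI[of _ "\<lambda>i. zero_arrow C c (X i)"] exI[of _ "{}"]) simp
  next
    case (finsums_inj i \<phi>)
    then show ?case
      by (intro exI[of _ "\<lambda>j. if j = i then \<phi> else zero_arrow C c (X j)"] exI[of _ "{i}"]) simp
  next
    case (finsums_plus f g)
    then obtain \<phi> F \<psi> G where
      \<phi>: "\<forall>i \<in> I. src C (\<phi> i) = c \<and> tgt C (\<phi> i) = X i" "finite F" "F \<subseteq> I"
        "\<forall>i \<in> I - F. \<phi> i = zero_arrow C c (X i)" "f = finprod (hom_group C c S) (\<lambda>i. \<iota> i \<cdot> \<phi> i) F" and
      \<psi>: "\<forall>i \<in> I. src C (\<psi> i) = c \<and> tgt C (\<psi> i) = X i" "finite G" "G \<subseteq> I"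
        "\<forall>i \<in> I - G. \<psi> i = zero_arrow C c (X i)" "g = finprod (hom_group C c S) (\<lambda>i. \<iota> i \<cdot> \<psi> i) G"
      by auto
    have f: "f = finprod (hom_group C c S) (\<lambda>i. \<iota> i \<cdot> \<phi> i) (F \<union> G)"
      unfolding \<phi>(5) by (rule A.finprod_mono_neutral_cong_left)
        (use \<phi>(1-4) \<psi>(1-4) in \<open>auto simp: subset_iff\<close>)
    have g: "g = finprod (hom_group C c S) (\<lambda>i. \<iota> i \<cdot> \<psi> i) (F \<union> G)"
      unfolding \<psi>(5) by (rule A.finprod_mono_neutral_cong_left)
        (use \<phi>(1-4) \<psi>(1-4) in \<open>auto simp: subset_iff\<close>)
    have "f \<oplus> g = finprod (hom_group C c S) (\<lambda>i. (\<iota> i \<cdot> \<phi> i) \<oplus> (\<iota> i \<cdot> \<psi> i)) (F \<union> G)"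
      unfolding f g
      by (subst A.finprod_multf[symmetric, simplified])
        (use \<phi>(1-4) \<psi>(1-4) in \<open>auto simp: subset_iff\<close>)
    also have "\<dots> = finprod (hom_group C c S) (\<lambda>i. \<iota> i \<cdot> (\<phi> i \<oplus> \<psi> i)) (F \<union> G)"
      by (rule A.finprod_cong') (use \<phi>(1-4) \<psi>(1-4) in \<open>auto simp: subset_iff cmp_plus\<close>)
    finally show ?case using \<phi>(1-4) \<psi>(1-4)
      by (intro exI[of _ "\<lambda>i. \<phi> i \<oplus> \<psi> i"] exI[of _ "F \<union> G"]) auto
  qed
qed

text \<open>Injectivity of the canonical map is automatic, since the projections of the coproduct
  return the coefficients; compactness is thus surjectivity.\<close>

lemma compact_object_iff:
  fixes U :: "'u itself"
  shows "compact_object U C c \<longleftrightarrow>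
    (\<forall>(I :: 'u set) X S \<iota>. small U I \<and> is_coproduct C I X S \<iota> \<longrightarrow> Hom C c S \<subseteq> finsums C I \<iota> c S)"
proof -
  have "bij_betw (\<lambda>\<phi>. finprod (hom_group C c S) (\<lambda>i. \<iota> i \<cdot> \<phi> i) {i \<in> I. \<phi> i \<noteq> zero_arrow C c (X i)})
      (hom_direct_sum C c I X) (Hom C c S) \<longleftrightarrow> Hom C c S \<subseteq> finsums C I \<iota> c S"
    (is "bij_betw ?\<Phi> ?D ?H \<longleftrightarrow> _")
    if S: "is_coproduct C I X S \<iota>" for I :: "'u set" and X S \<iota>
  proof -
    interpret A: comm_group "hom_group C c S" by (rule hom_comm_group)
    note [simp] = coproduct_inj[OF S]
    obtain \<pi> where \<pi>: "\<And>i. i \<in> I \<Longrightarrow> src C (\<pi> i) = S" "\<And>i. i \<in> I \<Longrightarrow> tgt C (\<pi> i) = X i"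
      "\<And>i j. \<lbrakk>i \<in> I; j \<in> I\<rbrakk> \<Longrightarrow> \<pi> i \<cdot> \<iota> j = (if i = j then ident C (X i) else zero_arrow C (X j) (X i))"
      using coproduct_proj[OF S] by metis
    have D: "src C (\<phi> i) = c" "tgt C (\<phi> i) = X i" if "\<phi> \<in> ?D" "i \<in> I" for \<phi> i
      using that by (auto simp: hom_direct_sum_def PiE_iff)
    have finsum: "?\<Phi> \<phi> = finprod (hom_group C c S) (\<lambda>i. \<iota> i \<cdot> \<phi> i) F"
      if "finite F" "F \<subseteq> I" "\<forall>i \<in> I. src C (\<phi> i) = c \<and> tgt C (\<phi> i) = X i"
        "\<forall>i \<in> I - F. \<phi> i = zero_arrow C c (X i)" for \<phi> F
      by (rule A.finprod_mono_neutral_cong_left) (use that in auto)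
    have in_finsums: "?\<Phi> \<phi> \<in> finsums C I \<iota> c S" if "\<phi> \<in> ?D" for \<phi>
      using that D[OF that] by (intro finprod_in_finsums) (auto simp: hom_direct_sum_def)
    have coeff: "\<pi> j \<cdot> ?\<Phi> \<phi> = \<phi> j" if \<phi>: "\<phi> \<in> ?D" and j: "j \<in> I" for \<phi> j
    proof -
      \<comment> \<open>The index \<open>j\<close> may lie outside the support, where its
        coefficient is zero; adding it makes the projection formula apply in either case.\<close>
      let ?F = "insert j {i \<in> I. \<phi> i \<noteq> zero_arrow C c (X i)}"
      have F: "finite ?F" "?F \<subseteq> I" using \<phi> j by (auto simp: hom_direct_sum_def)
      have "?\<Phi> \<phi> = finprod (hom_group C c S) (\<lambda>i. \<iota> i \<cdot> \<phi> i) ?F"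
        using F D[OF \<phi>] by (intro finsum) auto
      then show ?thesis
        using proj_finprod[OF S, of "\<pi> j" j \<phi> c ?F] \<pi>[OF j] D[OF \<phi>] F by simp
    qed
    have inj: "inj_on ?\<Phi> ?D"
    proof (rule inj_onI)
      fix \<phi> \<psi> assume D': "\<phi> \<in> ?D" "\<psi> \<in> ?D" and eq: "?\<Phi> \<phi> = ?\<Phi> \<psi>"
      then have "\<phi> \<in> (\<Pi>\<^sub>E i\<in>I. Hom C c (X i))" "\<psi> \<in> (\<Pi>\<^sub>E i\<in>I. Hom C c (X i))"
        by (simp_all only: hom_direct_sum_def mem_Collect_eq)
      then show "\<phi> = \<psi>"
      proof (rule PiE_ext)
        fix j assume "j \<in> I"
        from coeff[OF D'(1) this] coeff[OF D'(2) this] show "\<phi> j = \<psi> j" by (simp only: eq)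
      qed
    qed
    have sub: "?\<Phi> ` ?D \<subseteq> ?H" using finsums_typing[OF S in_finsums] by auto
    show ?thesis
    proof
      assume "bij_betw ?\<Phi> ?D ?H"
      then have "?H = ?\<Phi> ` ?D" by (simp add: bij_betw_def)
      with in_finsums show "?H \<subseteq> finsums C I \<iota> c S" by auto
    next
      assume H: "?H \<subseteq> finsums C I \<iota> c S"
      have "f \<in> ?\<Phi> ` ?D" if f: "f \<in> ?H" for f
      proof -
        have "f \<in> finsums C I \<iota> c S" using f H by blast
        from finsums_decompose[OF S this] obtain \<phi> F where
          \<phi>: "\<forall>i \<in> I. src C (\<phi> i) = c \<and> tgt C (\<phi> i) = X i" "finite F" "F \<subseteq> I"
          "\<forall>i \<in> I - F. \<phi> i = zero_arrow C c (X i)" "f = finprod (hom_group C c S) (\<lambda>i. \<iota> i \<cdot> \<phi> i) F"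
          by blast
        \<comment> \<open>The direct sum consists of extensional families, so the coefficients are
          made undefined off \<open>I\<close>.\<close>
        have "{i \<in> I. restrict \<phi> I i \<noteq> zero_arrow C c (X i)} \<subseteq> F" using \<phi>(4) by auto
        with \<phi>(2) have "finite {i \<in> I. restrict \<phi> I i \<noteq> zero_arrow C c (X i)}" by (rule rev_finite_subset)
        with \<phi>(1) have D: "restrict \<phi> I \<in> ?D"
          unfolding hom_direct_sum_def by (intro CollectI conjI) auto
        have "?\<Phi> (restrict \<phi> I) = finprod (hom_group C c S) (\<lambda>i. \<iota> i \<cdot> restrict \<phi> I i) F"
          using \<phi> by (intro finsum) auto
        also have "\<dots> = f" unfolding \<phi>(5)
          by (rule A.finprod_cong') (use \<phi>(1-3) in \<open>auto simp: subset_iff\<close>)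
        finally show ?thesis using D by (rule image_eqI[OF sym])
      qed
      then have "?H \<subseteq> ?\<Phi> ` ?D" by (rule subsetI)
      with sub have "?\<Phi> ` ?D = ?H" by (rule equalityI)
      with inj show "bij_betw ?\<Phi> ?D ?H" by (rule bij_betw_imageI)
    qed
  qed
  then show ?thesis unfolding compact_object_def by blast
qed

lemma compact_objectD:
  "\<lbrakk>compact_object U C c; is_coproduct C (I :: 'u set) X S \<iota>; small U I; src C f = c; tgt C f = S\<rbrakk>
    \<Longrightarrow> f \<in> finsums C I \<iota> c S"
  for U :: "'u itself"
  unfolding compact_object_iff by fastforce

lemma compact_objectI:
  fixes U :: "'u itself"
  assumes "\<And>(I :: 'u set) X S \<iota> f. \<lbrakk>is_coproduct C I X S \<iota>; small U I; src C f = c; tgt C f = S\<rbrakk>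
    \<Longrightarrow> f \<in> finsums C I \<iota> c S"
  shows "compact_object U C c"
  unfolding compact_object_iff using assms by auto

lemma finsums_precomp:
  assumes "is_coproduct C I X S \<iota>" "f \<in> finsums C I \<iota> c S" "tgt C k = c"
  shows "f \<cdot> k \<in> finsums C I \<iota> (src C k) S"
  using assms(2)
proof induction
  case finsums_zero
  then show ?case by (simp add: assms(3) finsums.finsums_zero)
next
  case (finsums_inj i \<phi>)
  then show ?case by (simp add: assms(3) assoc finsums.finsums_inj)
next
  case (finsums_plus f g)
  then show ?case
    using finsums_typing[OF assms(1)] assms(3) by (simp add: plus_cmp finsums.finsums_plus)
qed

lemma compact_retract:
  fixes U :: "'u itself"
  assumes "compact_object U C B" "src C i = X" "tgt C i = B" "src C p = B" "tgt C p = X" "p \<cdot> i = ident C X"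
  shows "compact_object U C X"
proof (rule compact_objectI)
  fix I :: "'u set" and Y S \<iota> f
  assume S: "is_coproduct C I Y S \<iota>" "small U I" and f: "src C f = X" "tgt C f = S"
  then have "f \<cdot> p \<in> finsums C I \<iota> B S" using assms by (intro compact_objectD) simp_all
  then have "(f \<cdot> p) \<cdot> i \<in> finsums C I \<iota> X S" using finsums_precomp[OF S(1)] assms by metis
  then show "f \<in> finsums C I \<iota> X S" using assms f by (simp add: assoc)
qed

lemma compact_isomorphic: "\<lbrakk>isomorphic C X Y; compact_object U C X\<rbrakk> \<Longrightarrow> compact_object U C Y"
  by (elim isomorphicE) (rule compact_retract)

lemma compact_zero: "is_zero C X \<Longrightarrow> compact_object U C X"
  by (rule compact_objectI) (metis finsums_zero is_zero_from)

end

section \<open>Compact objects form a triangulated subcategory\<close>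

context triangulated_category
begin

text \<open>A diagram chase on representatives: \<open>f \<cdot> v\<close> is a finite sum over some
  \<open>F\<close>. Let \<open>h\<close> be the part of \<open>f\<close> with coordinates in
  \<open>F\<close>. It agrees with \<open>f\<close> after \<open>v\<close>, so \<open>f - h\<close>
  factors through \<open>w\<close> and is a finite sum by compactness of the suspended
  source.\<close>

lemma compact_cone:
  fixes U :: "'u itself"
  assumes d: "dist T u v w" and c: "compact_object U T (tgt T u)" "compact_object U T (susp T (src T u))"
  shows "compact_object U T (tgt T v)"
proof (rule compact_objectI)
  note [simp] = dist_typing[OF d]
  fix I :: "'u set" and X S \<iota> f
  assume S: "is_coproduct T I X S \<iota>" and I: "small U I" and f: "src T f = tgt T v" "tgt T f = S"
  let ?a = "tgt T u" and ?b = "tgt T v"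
  note [simp] = coproduct_inj[OF S]
  obtain \<pi> where \<pi>: "\<And>i. i \<in> I \<Longrightarrow> src T (\<pi> i) = S" "\<And>i. i \<in> I \<Longrightarrow> tgt T (\<pi> i) = X i"
    "\<And>i j. \<lbrakk>i \<in> I; j \<in> I\<rbrakk> \<Longrightarrow> \<pi> i \<cdot> \<iota> j = (if i = j then ident T (X i) else zero_arrow T (X j) (X i))"
    using coproduct_proj[OF S] by metis
  have fv: "f \<cdot> v \<in> finsums T I \<iota> ?a S" using S I f c by (intro compact_objectD) simp_all
  from finsums_decompose[OF S this] obtain \<phi> F where
    \<phi>: "\<forall>i \<in> I. src T (\<phi> i) = ?a \<and> tgt T (\<phi> i) = X i" "finite F" "F \<subseteq> I"
    "f \<cdot> v = finprod (hom_group T ?a S) (\<lambda>i. \<iota> i \<cdot> \<phi> i) F"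
    by blast
  have \<phi>_eq: "\<phi> i = \<pi> i \<cdot> (f \<cdot> v)" if "i \<in> F" for i
  proof -
    have "i \<in> I" using that \<phi>(3) by blast
    then show ?thesis
      using proj_finprod[OF S, of "\<pi> i" i \<phi> ?a F] \<pi> \<phi> that by simp
  qed
  define h where "h = finprod (hom_group T ?b S) (\<lambda>i. \<iota> i \<cdot> (\<pi> i \<cdot> f)) F"
  have h: "h \<in> finsums T I \<iota> ?b S"
    unfolding h_def using \<phi>(2,3) \<pi> f by (intro finprod_in_finsums) (auto simp: subset_iff)
  note [simp] = finsums_typing[OF S h]
  interpret A: comm_group "hom_group T ?a S" by (rule hom_comm_group)
  have "h \<cdot> v = finprod (hom_group T ?a S) (\<lambda>i. (\<iota> i \<cdot> (\<pi> i \<cdot> f)) \<cdot> v) F"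
    unfolding h_def using \<phi>(2,3) \<pi> f
    by (subst finprod_cmp) (auto simp: subset_iff)
  also have "\<dots> = f \<cdot> v" unfolding \<phi>(4)
    by (rule A.finprod_cong') (use \<phi>(1-3) \<phi>_eq \<pi> f in \<open>auto simp: subset_iff assoc\<close>)
  finally have hv: "h \<cdot> v = f \<cdot> v" .
  let ?k = "f \<oplus> neg_arrow T h"
  have "?k \<cdot> v = zero_arrow T ?a S" using f by (simp add: plus_cmp neg_cmp hv)
  then obtain m where m: "src T m = susp T (src T u)" "tgt T m = S" "m \<cdot> w = ?k"
    using dist_weak_cokernel[OF dist_rot[OF d], of ?k] f by auto
  have "m \<in> finsums T I \<iota> (susp T (src T u)) S" using S I m c by (intro compact_objectD) simp_all
  then have "?k \<in> finsums T I \<iota> ?b S" using finsums_precomp[OF S, of m _ w] m by simp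
  then have "?k \<oplus> h \<in> finsums T I \<iota> ?b S" using h by (rule finsums_plus)
  then show "f \<in> finsums T I \<iota> ?b S" using f by (simp add: plus_assoc)
qed

text \<open>The suspension is fully faithful and essentially surjective, with no chosen inverse.
  Cocones are moved along an isomorphism of their vertex with some \<open>\<Sigma>Z'\<close> and
  desuspended there.\<close>

lemma susp_coproduct:
  assumes S: "is_coproduct T I X S \<iota>"
  shows "is_coproduct T I (\<lambda>i. susp T (X i)) (susp T S) (\<lambda>i. susp_arrow T (\<iota> i))"
proof (rule coproductI)
  note [simp] = coproduct_inj[OF S]
  fix Z h assume h: "\<And>i. i \<in> I \<Longrightarrow> src T (h i) = susp T (X i) \<and> tgt T (h i) = Z"
  obtain Z' where "isomorphic T (susp T Z') Z" using susp_essentially_surjective by blast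
  then obtain v v' where v: "src T v = susp T Z'" "tgt T v = Z" "src T v' = Z" "tgt T v' = susp T Z'"
    "v' \<cdot> v = ident T (susp T Z')" "v \<cdot> v' = ident T Z" by (rule isomorphicE)
  have "\<exists>h'. src T h' = X i \<and> tgt T h' = Z' \<and> susp_arrow T h' = v' \<cdot> h i" if "i \<in> I" for i
    using susp_arrow_full[of "v' \<cdot> h i" "X i" Z'] h[OF that] v by auto
  then obtain h' where h': "\<And>i. i \<in> I \<Longrightarrow> src T (h' i) = X i \<and> tgt T (h' i) = Z' \<and> susp_arrow T (h' i) = v' \<cdot> h i"
    by metis
  then obtain k where k: "src T k = S" "tgt T k = Z'" "\<And>i. i \<in> I \<Longrightarrow> k \<cdot> \<iota> i = h' i"
    using coproduct_lift[OF S, of h' Z'] by blast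
  show "\<exists>k. src T k = susp T S \<and> tgt T k = Z \<and> (\<forall>i\<in>I. k \<cdot> susp_arrow T (\<iota> i) = h i)"
    by (rule exI[of _ "v \<cdot> susp_arrow T k"])
      (use v k h h' in \<open>auto simp: assoc assoc_red[OF v(6)] simp flip: susp_arrow_cmp\<close>)
next
  note [simp] = coproduct_inj[OF S]
  fix k k' assume k: "src T k = susp T S" "src T k' = susp T S" "tgt T k = tgt T k'"
    "\<And>i. i \<in> I \<Longrightarrow> k \<cdot> susp_arrow T (\<iota> i) = k' \<cdot> susp_arrow T (\<iota> i)"
  obtain Z' where "isomorphic T (susp T Z') (tgt T k')" using susp_essentially_surjective by blast
  then obtain v v' where v: "src T v = susp T Z'" "tgt T v = tgt T k'" "src T v' = tgt T k'" "tgt T v' = susp T Z'"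
    "v' \<cdot> v = ident T (susp T Z')" "v \<cdot> v' = ident T (tgt T k')" by (rule isomorphicE)
  obtain m where m: "src T m = S" "tgt T m = Z'" "susp_arrow T m = v' \<cdot> k"
    using susp_arrow_full[of "v' \<cdot> k" S Z'] k v by auto
  obtain m' where m': "src T m' = S" "tgt T m' = Z'" "susp_arrow T m' = v' \<cdot> k'"
    using susp_arrow_full[of "v' \<cdot> k'" S Z'] k v by auto
  have "m = m'"
  proof (rule coproduct_eqI[OF S])
    fix i assume i: "i \<in> I"
    then have "susp_arrow T (m \<cdot> \<iota> i) = susp_arrow T (m' \<cdot> \<iota> i)"
      using k(1-3) k(4)[OF i] v m m' by (simp add: susp_arrow_cmp assoc)
    then show "m \<cdot> \<iota> i = m' \<cdot> \<iota> i" by (rule susp_arrow_inj) (use m m' i in simp_all)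
  qed (use m m' in simp_all)
  then have "v \<cdot> (v' \<cdot> k) = v \<cdot> (v' \<cdot> k')" using m m' by simp
  then show "k = k'" using v k by (simp add: assoc_red[OF v(6)])
qed (use S in \<open>simp_all add: coproduct_inj\<close>)

text \<open>The arrows \<open>a i\<close> and \<open>b\<close> are chosen isomorphisms onto the
  \<open>X i\<close> and \<open>S\<close> from suspensions, since these objects need not be
  suspensions themselves; \<open>\<iota>'\<close> desuspends the injections conjugated by
  them.\<close>

lemma desusp_coproduct:
  assumes S: "is_coproduct T I X S \<iota>"
    and a: "\<And>i. i \<in> I \<Longrightarrow> src T (a i) = susp T (X' i) \<and> tgt T (a i) = X i \<and>
      src T (a' i) = X i \<and> tgt T (a' i) = susp T (X' i) \<and> a i \<cdot> a' i = ident T (X i) \<and>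
      a' i \<cdot> a i = ident T (susp T (X' i))"
    and b: "src T b = susp T S'" "tgt T b = S" "src T b' = S" "tgt T b' = susp T S'"
      "b' \<cdot> b = ident T (susp T S')" "b \<cdot> b' = ident T S"
    and \<iota>': "\<And>i. i \<in> I \<Longrightarrow> src T (\<iota>' i) = X' i \<and> tgt T (\<iota>' i) = S' \<and> susp_arrow T (\<iota>' i) = b' \<cdot> (\<iota> i \<cdot> a i)"
  shows "is_coproduct T I X' S' \<iota>'"
proof (rule coproductI)
  note [simp] = coproduct_inj[OF S]
  have \<iota>: "\<iota> i = b \<cdot> (susp_arrow T (\<iota>' i) \<cdot> a' i)" if "i \<in> I" for i
    using a[OF that] \<iota>'[OF that] b that by (simp add: assoc assoc_red[OF b(6)])
  {
    fix Z h assume h: "\<And>i. i \<in> I \<Longrightarrow> src T (h i) = X' i \<and> tgt T (h i) = Z"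
    obtain k where k: "src T k = S" "tgt T k = susp T Z"
      "\<And>i. i \<in> I \<Longrightarrow> k \<cdot> \<iota> i = susp_arrow T (h i) \<cdot> a' i"
      using coproduct_lift[OF S, of "\<lambda>i. susp_arrow T (h i) \<cdot> a' i" "susp T Z"] h a by auto
    obtain m where m: "src T m = S'" "tgt T m = Z" "susp_arrow T m = k \<cdot> b"
      using susp_arrow_full[of "k \<cdot> b" S' Z] k b by auto
    have "m \<cdot> \<iota>' i = h i" if i: "i \<in> I" for i
    proof (rule susp_arrow_inj)
      have "susp_arrow T (m \<cdot> \<iota>' i) = (k \<cdot> \<iota> i) \<cdot> a i"
        using i a[OF i] b m k(1,2) \<iota>'[OF i] by (simp add: susp_arrow_cmp assoc assoc_red[OF b(6)])
      also have "\<dots> = susp_arrow T (h i)" using i a[OF i] h[OF i] by (simp add: k(3) assoc)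
      finally show "susp_arrow T (m \<cdot> \<iota>' i) = susp_arrow T (h i)" .
    qed (use m i \<iota>' h in auto)
    with m show "\<exists>k. src T k = S' \<and> tgt T k = Z \<and> (\<forall>i\<in>I. k \<cdot> \<iota>' i = h i)" by blast
  next
    fix k k' assume k: "src T k = S'" "src T k' = S'" "tgt T k = tgt T k'"
      "\<And>i. i \<in> I \<Longrightarrow> k \<cdot> \<iota>' i = k' \<cdot> \<iota>' i"
    have "susp_arrow T k \<cdot> b' = susp_arrow T k' \<cdot> b'"
    proof (rule coproduct_eqI[OF S])
      fix i assume i: "i \<in> I"
      have "(susp_arrow T k \<cdot> b') \<cdot> \<iota> i = susp_arrow T (k \<cdot> \<iota>' i) \<cdot> a' i"
        using i a[OF i] b k(1-3) \<iota>'[OF i] by (simp add: susp_arrow_cmp assoc)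
      also have "\<dots> = (susp_arrow T k' \<cdot> b') \<cdot> \<iota> i"
        using i a[OF i] b k(1-3) \<iota>'[OF i] by (simp add: k(4) susp_arrow_cmp assoc)
      finally show "(susp_arrow T k \<cdot> b') \<cdot> \<iota> i = (susp_arrow T k' \<cdot> b') \<cdot> \<iota> i" .
    qed (use b k in simp_all)
    then have "(susp_arrow T k \<cdot> b') \<cdot> b = (susp_arrow T k' \<cdot> b') \<cdot> b" by simp
    then have "susp_arrow T k = susp_arrow T k'" using b k by (simp add: assoc)
    then show "k = k'" by (rule susp_arrow_inj) (use k in simp_all)
  }
qed (use \<iota>' in auto)

text \<open>Up to isomorphism every coproduct is the suspension of a coproduct, and a map from
  \<open>\<Sigma>c\<close> desuspends to a map from \<open>c\<close>. The finite sum found there is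
  suspended and carried back by \<open>b\<close>.\<close>

lemma compact_susp:
  fixes U :: "'u itself"
  assumes c: "compact_object U T c"
  shows "compact_object U T (susp T c)"
proof (rule compact_objectI)
  fix I :: "'u set" and X S \<iota> f
  assume S: "is_coproduct T I X S \<iota>" and I: "small U I" and f: "src T f = susp T c" "tgt T f = S"
  note [simp] = coproduct_inj[OF S]
  have ex: "\<exists>Z' b b'. src T b = susp T Z' \<and> tgt T b = Z \<and> src T b' = Z \<and> tgt T b' = susp T Z' \<and>
      b \<cdot> b' = ident T Z \<and> b' \<cdot> b = ident T (susp T Z')" for Z
    using susp_essentially_surjective[of Z] by (metis isomorphicE)
  obtain S' b b' where b: "src T b = susp T S'" "tgt T b = S" "src T b' = S" "tgt T b' = susp T S'"
    "b \<cdot> b' = ident T S" "b' \<cdot> b = ident T (susp T S')" using ex[of S] by blast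
  obtain X' a a' where a: "\<And>i. src T (a i) = susp T (X' i) \<and> tgt T (a i) = X i \<and>
      src T (a' i) = X i \<and> tgt T (a' i) = susp T (X' i) \<and> a i \<cdot> a' i = ident T (X i) \<and>
      a' i \<cdot> a i = ident T (susp T (X' i))"
    using ex[of "X i" for i] by metis
  have "\<exists>\<iota>'. src T \<iota>' = X' i \<and> tgt T \<iota>' = S' \<and> susp_arrow T \<iota>' = b' \<cdot> (\<iota> i \<cdot> a i)" if "i \<in> I" for i
    using susp_arrow_full[of "b' \<cdot> (\<iota> i \<cdot> a i)" "X' i" S'] b a that by auto
  then obtain \<iota>' where \<iota>': "\<And>i. i \<in> I \<Longrightarrow> src T (\<iota>' i) = X' i \<and> tgt T (\<iota>' i) = S' \<and>
      susp_arrow T (\<iota>' i) = b' \<cdot> (\<iota> i \<cdot> a i)"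
    by metis
  have S': "is_coproduct T I X' S' \<iota>'"
    by (rule desusp_coproduct[OF S a b(1-4) b(6,5) \<iota>'])
  have transfer: "b \<cdot> susp_arrow T g \<in> finsums T I \<iota> (susp T c) S" if "g \<in> finsums T I \<iota>' c S'" for g
    using that
  proof induction
    case finsums_zero
    then show ?case using finsums.finsums_zero b by simp
  next
    case (finsums_inj i \<phi>)
    have "b \<cdot> susp_arrow T (\<iota>' i \<cdot> \<phi>) = \<iota> i \<cdot> (a i \<cdot> susp_arrow T \<phi>)"
      using finsums_inj \<iota>'[OF finsums_inj(1)] a[of i] b
      by (simp add: susp_arrow_cmp assoc assoc_red[OF b(5)])
    then show ?case using finsums_inj \<iota>'[OF finsums_inj(1)] a[of i]
      by (simp add: finsums.finsums_inj)
  next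
    case (finsums_plus f g)
    note t = finsums_typing[OF S' finsums_plus.hyps(1)] finsums_typing[OF S' finsums_plus.hyps(2)]
    show ?case using finsums_plus.IH t b
      by (simp add: susp_arrow_plus cmp_plus finsums.finsums_plus)
  qed
  obtain g where g: "src T g = c" "tgt T g = S'" "susp_arrow T g = b' \<cdot> f"
    using susp_arrow_full[of "b' \<cdot> f" c S'] b f by auto
  have "g \<in> finsums T I \<iota>' c S'" by (rule compact_objectD[OF c S' I g(1,2)])
  from transfer[OF this] show "f \<in> finsums T I \<iota> (susp T c) S"
    using g b f by (simp add: assoc_red[OF b(5)])
qed

lemma compact_desusp:
  fixes U :: "'u itself"
  assumes c: "compact_object U T (susp T c)"
  shows "compact_object U T c"
proof (rule compact_objectI)
  fix I :: "'u set" and X S \<iota> f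
  assume S: "is_coproduct T I X S \<iota>" and I: "small U I" and f: "src T f = c" "tgt T f = S"
  note [simp] = coproduct_inj[OF S]
  have "g \<in> finsums T I (\<lambda>i. susp_arrow T (\<iota> i)) (susp T c) (susp T S) \<Longrightarrow>
      \<exists>f \<in> finsums T I \<iota> c S. susp_arrow T f = g" for g
  proof (induction rule: finsums.induct)
    case finsums_zero
    show ?case by (rule bexI[OF _ finsums.finsums_zero]) simp
  next
    case (finsums_inj i \<phi>)
    then obtain \<psi> where "src T \<psi> = c" "tgt T \<psi> = X i" "susp_arrow T \<psi> = \<phi>"
      using susp_arrow_full[of \<phi> c "X i"] by auto
    then show ?case using finsums_inj(1)
      by (intro bexI[of _ "\<iota> i \<cdot> \<psi>"]) (simp_all add: susp_arrow_cmp finsums.finsums_inj)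
  next
    case (finsums_plus g h)
    then obtain g' h' where "g' \<in> finsums T I \<iota> c S" "susp_arrow T g' = g"
      "h' \<in> finsums T I \<iota> c S" "susp_arrow T h' = h" by blast
    then show ?case
      using finsums_typing[OF S]
      by (intro bexI[of _ "g' \<oplus> h'"]) (simp_all add: susp_arrow_plus finsums.finsums_plus)
  qed
  moreover have "susp_arrow T f \<in> finsums T I (\<lambda>i. susp_arrow T (\<iota> i)) (susp T c) (susp T S)"
    by (rule compact_objectD[OF c susp_coproduct[OF S] I]) (simp_all add: f)
  ultimately obtain f' where f': "f' \<in> finsums T I \<iota> c S" "susp_arrow T f' = susp_arrow T f" by blast
  have "f' = f" by (rule susp_arrow_inj[OF f'(2)]) (use finsums_typing[OF S f'(1)] f in simp_all)
  with f' show "f \<in> finsums T I \<iota> c S" by simp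
qed

lemma triangulated_compact_part: "triangulated_subcategory T (compact_part U T)"
  unfolding triangulated_subcategory_def compact_part_def mem_Collect_eq
  using compact_zero compact_isomorphic compact_susp compact_desusp compact_cone by blast

end

section \<open>The tensor product\<close>

context symmetric_monoidal_category
begin

lemma src_tensor [simp]: "src T (f \<star> g) = src T f \<boxtimes> src T g"
  and tgt_tensor [simp]: "tgt T (f \<star> g) = tgt T f \<boxtimes> tgt T g"
  using tensor_in_Hom[of f "src T f" "tgt T f" g "src T g" "tgt T g"] by auto

lemma structure_typing [simp]:
  "src T (associator T X Y Z) = (X \<boxtimes> Y) \<boxtimes> Z" "tgt T (associator T X Y Z) = X \<boxtimes> (Y \<boxtimes> Z)"
  "src T (left_unitor T X) = tunit T \<boxtimes> X" "tgt T (left_unitor T X) = X"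
  "src T (right_unitor T X) = X \<boxtimes> tunit T" "tgt T (right_unitor T X) = X"
  "src T (symm T X Y) = X \<boxtimes> Y" "tgt T (symm T X Y) = Y \<boxtimes> X"
  using associator_in_Hom[of X Y Z] left_unitor_in_Hom[of X] right_unitor_in_Hom[of X]
    symm_in_Hom[of X Y] by auto

lemma tensor_arrow_cmp:
  "\<lbrakk>tgt T f = src T g; tgt T f' = src T g'\<rbrakk> \<Longrightarrow> (g \<star> g') \<cdot> (f \<star> f') = (g \<cdot> f) \<star> (g' \<cdot> f')"
  by (rule tensor_cmp[symmetric, of _ "src T f" "tgt T f" _ "tgt T g" _ "src T f'" "tgt T f'" _ "tgt T g'"])
    auto

lemma associator_nat:
  "\<lbrakk>src T f = X; src T g = Y; src T h = Z; tgt T f = X'; tgt T g = Y'; tgt T h = Z'\<rbrakk> \<Longrightarrow>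
    associator T X' Y' Z' \<cdot> ((f \<star> g) \<star> h) = (f \<star> (g \<star> h)) \<cdot> associator T X Y Z"
  by (rule associator_natural) auto

lemma left_unitor_nat:
  "\<lbrakk>src T f = X; tgt T f = Y\<rbrakk> \<Longrightarrow>
    left_unitor T Y \<cdot> (ident T (tunit T) \<star> f) = f \<cdot> left_unitor T X"
  by (rule left_unitor_natural) auto

lemma right_unitor_nat:
  "\<lbrakk>src T f = X; tgt T f = Y\<rbrakk> \<Longrightarrow>
    right_unitor T Y \<cdot> (f \<star> ident T (tunit T)) = f \<cdot> right_unitor T X"
  by (rule right_unitor_natural) auto

lemma isomorphic_tensor:
  assumes "isomorphic T X X'" "isomorphic T Y Y'"
  shows "isomorphic T (X \<boxtimes> Y) (X' \<boxtimes> Y')"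
proof -
  obtain f g where 1: "src T f = X" "tgt T f = X'" "src T g = X'" "tgt T g = X"
    "g \<cdot> f = ident T X" "f \<cdot> g = ident T X'"
    using assms(1) by (rule isomorphicE)
  obtain h k where 2: "src T h = Y" "tgt T h = Y'" "src T k = Y'" "tgt T k = Y"
    "k \<cdot> h = ident T Y" "h \<cdot> k = ident T Y'"
    using assms(2) by (rule isomorphicE)
  show ?thesis
    by (rule isomorphicI[of "f \<star> h" _ _ "g \<star> k"]) (simp_all add: 1 2 tensor_arrow_cmp tensor_ident)
qed

lemma isomorphic_associator: "isomorphic T ((X \<boxtimes> Y) \<boxtimes> Z) (X \<boxtimes> (Y \<boxtimes> Z))"
  using isomorphic_iso_arrow[OF associator_iso[of X Y Z]] by simp

lemma isomorphic_left_unitor: "isomorphic T (tunit T \<boxtimes> X) X"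
  using isomorphic_iso_arrow[OF left_unitor_iso[of X]] by simp

lemma isomorphic_symm: "isomorphic T (X \<boxtimes> Y) (Y \<boxtimes> X)"
  by (rule isomorphicI[of "symm T X Y" _ _ "symm T Y X"]) (simp_all add: symm_symm)

lemma isomorphic_swap_right: "isomorphic T ((X \<boxtimes> Y) \<boxtimes> Z) ((X \<boxtimes> Z) \<boxtimes> Y)"
  by (meson isomorphic_associator isomorphic_refl isomorphic_sym isomorphic_symm isomorphic_tensor
      isomorphic_trans)

text \<open>The right unitor identifies \<open>- \<otimes> \<one>\<close> with the identity functor,
  so an equation of arrows may be checked after tensoring with the unit, where the coherence axioms
  apply.\<close>

lemma tensor_unit_faithful:
  assumes "f \<star> ident T (tunit T) = g \<star> ident T (tunit T)" "src T f = src T g" "tgt T f = tgt T g"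
  shows "f = g"
proof (rule iso_cancel_right)
  have "f \<cdot> right_unitor T (src T g) = right_unitor T (tgt T g) \<cdot> (f \<star> ident T (tunit T))"
    using assms right_unitor_nat[of f] by simp
  also have "\<dots> = g \<cdot> right_unitor T (src T g)" unfolding assms(1) by (rule right_unitor_nat) simp_all
  finally show "f \<cdot> right_unitor T (src T g) = g \<cdot> right_unitor T (src T g)" .
qed (simp_all add: assms right_unitor_iso)

lemma unit_tensor_faithful:
  assumes "ident T (tunit T) \<star> f = ident T (tunit T) \<star> g" "src T f = src T g" "tgt T f = tgt T g"
  shows "f = g"
proof (rule iso_cancel_right)
  have "f \<cdot> left_unitor T (src T g) = left_unitor T (tgt T g) \<cdot> (ident T (tunit T) \<star> f)"
    using assms left_unitor_nat[of f] by simp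
  also have "\<dots> = g \<cdot> left_unitor T (src T g)" unfolding assms(1) by (rule left_unitor_nat) simp_all
  finally show "f \<cdot> left_unitor T (src T g) = g \<cdot> left_unitor T (src T g)" .
qed (simp_all add: assms left_unitor_iso)

text \<open>Kelly's redundant unit axioms: tensoring with the unit turns them into instances of the pentagon.\<close>

lemma right_unitor_tensor:
  "right_unitor T (X \<boxtimes> Y) = (ident T X \<star> right_unitor T Y) \<cdot> associator T X Y (tunit T)"
proof (rule tensor_unit_faithful)
  let ?I = "tunit T"
  let ?i = "ident T ?I" and ?x = "ident T X" and ?y = "ident T Y" and ?l = "left_unitor T ?I"
  have "associator T X Y ?I \<cdot> (right_unitor T (X \<boxtimes> Y) \<star> ?i) =
      associator T X Y ?I \<cdot> (((?x \<star> ?y) \<star> ?l) \<cdot> associator T (X \<boxtimes> Y) ?I ?I)"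
    by (simp add: unit_triangle[symmetric] tensor_ident)
  also have "\<dots> = (?x \<star> (?y \<star> ?l)) \<cdot> (associator T X Y (?I \<boxtimes> ?I) \<cdot> associator T (X \<boxtimes> Y) ?I ?I)"
    by (simp add: assoc assoc_red[OF associator_nat])
  also have "\<dots> = ((?x \<star> (?y \<star> ?l)) \<cdot> (?x \<star> associator T Y ?I ?I)) \<cdot>
      (associator T X (Y \<boxtimes> ?I) ?I \<cdot> (associator T X Y ?I \<star> ?i))"
    by (simp add: pentagon assoc)
  also have "\<dots> = (?x \<star> (right_unitor T Y \<star> ?i)) \<cdot>
      (associator T X (Y \<boxtimes> ?I) ?I \<cdot> (associator T X Y ?I \<star> ?i))"
    by (simp add: tensor_arrow_cmp unit_triangle)
  also have "\<dots> = associator T X Y ?I \<cdot> (((?x \<star> right_unitor T Y) \<cdot> associator T X Y ?I) \<star> ?i)"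
    by (simp add: assoc_red[OF associator_nat[symmetric]] assoc tensor_arrow_cmp)
  finally show "right_unitor T (X \<boxtimes> Y) \<star> ?i =
      ((?x \<star> right_unitor T Y) \<cdot> associator T X Y ?I) \<star> ?i"
    by (rule iso_cancel_left) (simp_all add: associator_iso)
qed simp_all

text \<open>Naturality of the right unitor at its own component on \<open>\<one>\<close> gives
  \<open>\<rho> \<otimes> \<one> = \<rho>\<close> on \<open>\<one> \<otimes> \<one>\<close>.
  Comparing the unit triangle with \<open>right_unitor_tensor\<close> and cancelling the associator
  leaves the claim.\<close>

lemma left_unitor_unit: "left_unitor T (tunit T) = right_unitor T (tunit T)"
proof (rule unit_tensor_faithful)
  let ?I = "tunit T"
  have "right_unitor T ?I \<cdot> (right_unitor T ?I \<star> ident T ?I) = right_unitor T ?I \<cdot> right_unitor T (?I \<boxtimes> ?I)"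
    by (rule right_unitor_nat) simp_all
  then have "right_unitor T ?I \<star> ident T ?I = right_unitor T (?I \<boxtimes> ?I)"
    by (rule iso_cancel_left) (simp_all add: right_unitor_iso)
  then have "(ident T ?I \<star> left_unitor T ?I) \<cdot> associator T ?I ?I ?I =
      (ident T ?I \<star> right_unitor T ?I) \<cdot> associator T ?I ?I ?I"
    by (simp add: unit_triangle right_unitor_tensor)
  then show "ident T ?I \<star> left_unitor T ?I = ident T ?I \<star> right_unitor T ?I"
    by (rule iso_cancel_right) (simp_all add: associator_iso)
qed simp_all

text \<open>The unit is its own dual: evaluation is the right unitor and coevaluation its inverse.
  Both zigzags reduce to the unit triangle once the two unitors agree on
  \<open>\<one>\<close>.\<close>

lemma rigid_unit: "rigid T (tunit T)"
proof -
  let ?I = "tunit T"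
  let ?i = "ident T ?I" and ?r = "right_unitor T ?I" and ?\<alpha> = "associator T ?I ?I ?I"
  obtain c where c: "src T c = ?I" "tgt T c = ?I \<boxtimes> ?I" "?r \<cdot> c = ?i"
    using right_unitor_iso[of ?I] by (auto elim: iso_arrowE)
  obtain a where a: "inverse_arrows T ?\<alpha> a" using associator_iso unfolding iso_arrow_def by blast
  then have a': "src T a = ?I \<boxtimes> (?I \<boxtimes> ?I)" "tgt T a = (?I \<boxtimes> ?I) \<boxtimes> ?I" "?\<alpha> \<cdot> a = ident T (?I \<boxtimes> (?I \<boxtimes> ?I))"
    by (simp_all add: inverse_arrows_def)
  have tri: "(?i \<star> ?r) \<cdot> ?\<alpha> = ?r \<star> ?i" using unit_triangle[of ?I ?I] by (simp add: left_unitor_unit)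
  have "?r \<cdot> (?i \<star> ?r) \<cdot> ?\<alpha> \<cdot> (c \<star> ?i) = left_unitor T ?I"
    by (simp add: assoc_red[OF tri] c tensor_arrow_cmp tensor_ident left_unitor_unit)
  moreover have "left_unitor T ?I \<cdot> (?r \<star> ?i) \<cdot> a \<cdot> (?i \<star> c) = ?r"
    by (simp flip: tri add: assoc assoc_red[OF a'(3)] a' c tensor_arrow_cmp tensor_ident left_unitor_unit)
  ultimately show ?thesis
    unfolding rigid_def using a c
    by (intro exI[of _ ?I] bexI[of _ ?r] bexI[of _ c] conjI exI[of _ a]) (simp_all add: left_unitor_unit)
qed

end

section \<open>Exactness of the tensor product, duals and localizing ideals\<close>

context tensor_triangulated_category
begin

lemma susp_tensor_typing [simp]:
  "src T (susp_tensor T X Y) = susp T X \<boxtimes> Y" "tgt T (susp_tensor T X Y) = susp T (X \<boxtimes> Y)"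
  using susp_tensor_in_Hom[of X Y] by auto

lemma plus_tensor:
  "\<lbrakk>src T f = src T g; tgt T f = tgt T g\<rbrakk> \<Longrightarrow> (f \<oplus> g) \<star> h = (f \<star> h) \<oplus> (g \<star> h)"
  by (rule tensor_plus[of _ "src T f" "tgt T f" _ _ "src T h" "tgt T h"]) auto

lemma zero_tensor: "zero_arrow T X Y \<star> f = zero_arrow T (X \<boxtimes> src T f) (Y \<boxtimes> tgt T f)"
proof -
  have "(zero_arrow T X Y \<star> f) \<oplus> (zero_arrow T X Y \<star> f) = zero_arrow T X Y \<star> f"
    by (simp flip: plus_tensor)
  from plus_self_zero[OF this] show ?thesis by simp
qed

lemma is_zero_tensor: "is_zero T X \<Longrightarrow> is_zero T (X \<boxtimes> Y)"
  by (simp add: is_zero_def zero_tensor flip: tensor_ident)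

text \<open>\<open>- \<otimes> W\<close> is a left adjoint by the internal hom: cocones under the
  \<open>X i \<otimes> W\<close> transpose to cocones under the \<open>X i\<close>.\<close>

lemma tensor_coproduct:
  assumes S: "is_coproduct T I X S \<iota>"
  shows "is_coproduct T I (\<lambda>i. X i \<boxtimes> W) (S \<boxtimes> W) (\<lambda>i. \<iota> i \<star> ident T W)"
proof (rule coproductI)
  note [simp] = coproduct_inj[OF S]
  {
    fix Z h assume h: "\<And>i. i \<in> I \<Longrightarrow> src T (h i) = X i \<boxtimes> W \<and> tgt T (h i) = Z"
    obtain H ev where "is_internal_hom T W Z H ev" using ex_internal_hom by blast
    then have ev: "src T ev = H \<boxtimes> W" "tgt T ev = Z"
      and hom: "\<And>V k. \<lbrakk>src T k = V \<boxtimes> W; tgt T k = Z\<rbrakk> \<Longrightarrow>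
        \<exists>!h. (src T h = V \<and> tgt T h = H) \<and> ev \<cdot> (h \<star> ident T W) = k"
      by (simp_all add: is_internal_hom_def)
    have "\<exists>h'. src T h' = X i \<and> tgt T h' = H \<and> ev \<cdot> (h' \<star> ident T W) = h i" if "i \<in> I" for i
      using hom h that by blast
    then obtain h' where h': "\<And>i. i \<in> I \<Longrightarrow> src T (h' i) = X i \<and> tgt T (h' i) = H \<and> ev \<cdot> (h' i \<star> ident T W) = h i"
      by metis
    then obtain k where k: "src T k = S" "tgt T k = H" "\<And>i. i \<in> I \<Longrightarrow> k \<cdot> \<iota> i = h' i"
      using coproduct_lift[OF S, of h' H] by blast
    show "\<exists>k. src T k = S \<boxtimes> W \<and> tgt T k = Z \<and> (\<forall>i\<in>I. k \<cdot> (\<iota> i \<star> ident T W) = h i)"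
      by (rule exI[of _ "ev \<cdot> (k \<star> ident T W)"]) (simp add: k ev assoc tensor_arrow_cmp h')
  next
    fix k k' assume k: "src T k = S \<boxtimes> W" "src T k' = S \<boxtimes> W" "tgt T k = tgt T k'"
      "\<And>i. i \<in> I \<Longrightarrow> k \<cdot> (\<iota> i \<star> ident T W) = k' \<cdot> (\<iota> i \<star> ident T W)"
    obtain H ev where "is_internal_hom T W (tgt T k') H ev" using ex_internal_hom by blast
    then have ev: "src T ev = H \<boxtimes> W" "tgt T ev = tgt T k'"
      and hom: "\<And>V l. \<lbrakk>src T l = V \<boxtimes> W; tgt T l = tgt T k'\<rbrakk> \<Longrightarrow>
        \<exists>!h. (src T h = V \<and> tgt T h = H) \<and> ev \<cdot> (h \<star> ident T W) = l"
      by (simp_all add: is_internal_hom_def)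
    obtain m where m: "src T m = S" "tgt T m = H" "ev \<cdot> (m \<star> ident T W) = k"
      using hom[of k S] k by auto
    obtain m' where m': "src T m' = S" "tgt T m' = H" "ev \<cdot> (m' \<star> ident T W) = k'"
      using hom[of k' S] k by auto
    have "m = m'"
    proof (rule coproduct_eqI[OF S])
      fix i assume i: "i \<in> I"
      have m_eq: "ev \<cdot> ((m \<cdot> \<iota> i) \<star> ident T W) = k \<cdot> (\<iota> i \<star> ident T W)"
        using i by (simp add: m ev assoc tensor_arrow_cmp flip: m(3))
      have m'_eq: "ev \<cdot> ((m' \<cdot> \<iota> i) \<star> ident T W) = k \<cdot> (\<iota> i \<star> ident T W)"
        unfolding k(4)[OF i] using i by (simp add: m' ev assoc tensor_arrow_cmp flip: m'(3))
      have "\<exists>!h. (src T h = X i \<and> tgt T h = H) \<and> ev \<cdot> (h \<star> ident T W) = k \<cdot> (\<iota> i \<star> ident T W)"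
        by (rule hom) (use i k in simp_all)
      then show "m \<cdot> \<iota> i = m' \<cdot> \<iota> i"
        by (rule ex1E) (metis i m(1,2) m'(1,2) m_eq m'_eq src_cmp tgt_cmp coproduct_inj[OF S])
    qed (simp_all add: m m')
    then show "k = k'" using m m' by simp
  }
qed (simp_all add: coproduct_inj[OF S])

lemma triangulated_tensor_vimage:
  assumes L: "triangulated_subcategory T L"
  shows "triangulated_subcategory T {X. X \<boxtimes> W \<in> L}"
  unfolding triangulated_subcategory_def mem_Collect_eq
proof (intro conjI allI impI; (elim conjE)?)
  note tri = triangulated_subcategoryD[OF L]
  show "X \<boxtimes> W \<in> L" if "is_zero T X" for X
    using that is_zero_tensor tri(1) by blast
  show "Y \<boxtimes> W \<in> L" if "X \<boxtimes> W \<in> L" "isomorphic T X Y" for X Y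
    using that isomorphic_tensor isomorphic_refl tri(2) by blast
  have "isomorphic T (susp T X \<boxtimes> W) (susp T (X \<boxtimes> W))" for X
    using isomorphic_iso_arrow[OF susp_tensor_iso[of X W]] by simp
  then show "susp T X \<boxtimes> W \<in> L \<longleftrightarrow> X \<boxtimes> W \<in> L" for X
    using tri(2,3) isomorphic_sym by blast
  show "tgt T g \<boxtimes> W \<in> L" if "dist T f g h" "src T f \<boxtimes> W \<in> L" "tgt T f \<boxtimes> W \<in> L" for f g h
    using tri(4)[OF tensor_exact[OF that(1), of "src T f" "tgt T f" W]] that(2,3) by simp
qed

lemma localizing_tensor_vimage:
  fixes U :: "'u itself"
  assumes L: "localizing U T L"
  shows "localizing U T {X. X \<boxtimes> W \<in> L}"
proof -
  have "S \<in> {X. X \<boxtimes> W \<in> L}"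
    if "small U I" "\<forall>i\<in>I. X i \<in> {X. X \<boxtimes> W \<in> L}" "is_coproduct T I X S \<iota>" for I :: "'u set" and X S \<iota>
    using localizing_coproduct[OF L tensor_coproduct[OF that(3)] that(1)] that(2) by simp
  then show ?thesis
    using triangulated_tensor_vimage[OF localizing_triangulated[OF L]] unfolding localizing_def by blast
qed

lemma biproduct_tensor:
  assumes "is_biproduct T B X Y"
  shows "is_biproduct T (B \<boxtimes> W) (X \<boxtimes> W) (Y \<boxtimes> W)"
proof -
  obtain i j p q where [simp]: "src T i = X" "tgt T i = B" "src T j = Y" "tgt T j = B"
    "src T p = B" "tgt T p = X" "src T q = B" "tgt T q = Y"
    and "p \<cdot> i = ident T X" "q \<cdot> j = ident T Y" "q \<cdot> i = zero_arrow T X Y" "p \<cdot> j = zero_arrow T Y X"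
      "i \<cdot> p \<oplus> j \<cdot> q = ident T B"
    using assms unfolding is_biproduct_def Bex_def Hom_iff by blast
  then show ?thesis unfolding is_biproduct_def
    by (intro bexI[of _ "i \<star> ident T W"] bexI[of _ "j \<star> ident T W"] bexI[of _ "p \<star> ident T W"]
        bexI[of _ "q \<star> ident T W"])
      (simp_all add: tensor_arrow_cmp tensor_ident zero_tensor flip: plus_tensor)
qed

lemma localizing_idealD:
  "localizing_ideal U T L \<Longrightarrow> localizing U T L"
  "\<lbrakk>localizing_ideal U T L; X \<in> L\<rbrakk> \<Longrightarrow> X \<boxtimes> Y \<in> L"
  "\<lbrakk>localizing_ideal U T L; isomorphic T X Y; X \<in> L\<rbrakk> \<Longrightarrow> Y \<in> L"
  by (auto simp: localizing_ideal_def dest: localizing_triangulated triangulated_subcategoryD(2))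

text \<open>This is the ideal quotient of \<open>L\<close> by \<open>W\<close>, the source of the
  auxiliary ideals: \<open>M\<close> with \<open>W = t\<close>, and later quotients of
  \<open>M\<close> itself. Closure under tensoring comes from moving the new factor past
  \<open>W\<close>.\<close>

lemma localizing_ideal_vimage:
  assumes L: "localizing_ideal U T L"
  shows "localizing_ideal U T {X. X \<boxtimes> W \<in> L}"
  unfolding localizing_ideal_def
proof (intro conjI ballI allI)
  show "localizing U T {X. X \<boxtimes> W \<in> L}" using localizing_tensor_vimage localizing_idealD(1)[OF L] .
  fix X Y assume "X \<in> {X. X \<boxtimes> W \<in> L}"
  then have "(X \<boxtimes> W) \<boxtimes> Y \<in> L" using localizing_idealD(2)[OF L] by simp
  then show "X \<boxtimes> Y \<in> {X. X \<boxtimes> W \<in> L}"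
    using localizing_idealD(3)[OF L isomorphic_swap_right] by simp
qed

text \<open>
  If \<open>X\<close> has a dual \<open>D\<close>, a map \<open>f : Y \<otimes> X \<rightarrow> S\<close> is recovered from its transpose \<open>Y \<rightarrow> S \<otimes> D\<close>, and
  the transposition back preserves finite sums of maps through the injections.
\<close>

lemma compact_tensor_rigid:
  fixes U :: "'u itself"
  assumes Y: "compact_object U T Y" and X: "rigid T X"
  shows "compact_object U T (Y \<boxtimes> X)"
proof (rule compact_objectI)
  fix I :: "'u set" and Z S \<iota> f
  assume S: "is_coproduct T I Z S \<iota>" and I: "small U I" and f [simp]: "src T f = Y \<boxtimes> X" "tgt T f = S"
  note [simp] = coproduct_inj[OF S]
  let ?I = "tunit T" and ?x = "ident T X" and ?y = "ident T Y"
  obtain D ev coev where [simp]: "src T ev = D \<boxtimes> X" "tgt T ev = ?I" "src T coev = ?I" "tgt T coev = X \<boxtimes> D"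
    and zigzag: "right_unitor T X \<cdot> (?x \<star> ev) \<cdot> associator T X D X \<cdot> (coev \<star> ?x) = left_unitor T X"
    using X unfolding rigid_def by auto
  let ?d = "ident T D"
  obtain a where [simp]: "src T a = Y \<boxtimes> (X \<boxtimes> D)" "tgt T a = (Y \<boxtimes> X) \<boxtimes> D"
    and a: "associator T Y X D \<cdot> a = ident T (Y \<boxtimes> (X \<boxtimes> D))"
    using associator_iso[of Y X D] by (auto elim: iso_arrowE)
  obtain r where [simp]: "src T r = Y" "tgt T r = Y \<boxtimes> ?I" and r: "right_unitor T Y \<cdot> r = ?y"
    using right_unitor_iso[of Y] by (auto elim: iso_arrowE)
  \<comment> \<open>\<open>up\<close> and \<open>\<eta>\<close> belong to the adjunction between
    \<open>- \<otimes> X\<close> and \<open>- \<otimes> D\<close>: \<open>up\<close> transposes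
    \<open>Y \<rightarrow> S \<otimes> D\<close> back by its counit, and \<open>\<eta>\<close> is
    its unit at \<open>Y\<close>.\<close>
  define up where "up g = right_unitor T S \<cdot> (ident T S \<star> ev) \<cdot> associator T S D X \<cdot> (g \<star> ?x)" for g
  define \<eta> where "\<eta> = a \<cdot> (?y \<star> coev) \<cdot> r"
  have [simp]: "src T \<eta> = Y" "tgt T \<eta> = (Y \<boxtimes> X) \<boxtimes> D" by (simp_all add: \<eta>_def)
  have pent: "associator T Y X (D \<boxtimes> X) \<cdot> associator T (Y \<boxtimes> X) D X \<cdot> (a \<star> ?x) =
      (?y \<star> associator T X D X) \<cdot> associator T Y (X \<boxtimes> D) X"
    by (simp add: assoc_red[OF pentagon] assoc tensor_arrow_cmp a tensor_ident)
  \<comment> \<open>A triangle identity of the adjunction. The associators are rearranged until the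
    zigzag of \<open>X\<close> appears tensored with \<open>Y\<close>.\<close>
  have "right_unitor T (Y \<boxtimes> X) \<cdot> (ident T (Y \<boxtimes> X) \<star> ev) \<cdot> associator T (Y \<boxtimes> X) D X \<cdot> (\<eta> \<star> ?x)
      = (?y \<star> right_unitor T X) \<cdot> associator T Y X ?I \<cdot> ((?y \<star> ?x) \<star> ev) \<cdot> associator T (Y \<boxtimes> X) D X \<cdot>
        (a \<star> ?x) \<cdot> ((?y \<star> coev) \<star> ?x) \<cdot> (r \<star> ?x)"
    by (simp add: right_unitor_tensor assoc tensor_arrow_cmp tensor_ident \<eta>_def)
  also have "\<dots> = (?y \<star> right_unitor T X) \<cdot> (?y \<star> (?x \<star> ev)) \<cdot>
        (associator T Y X (D \<boxtimes> X) \<cdot> associator T (Y \<boxtimes> X) D X \<cdot> (a \<star> ?x)) \<cdot> ((?y \<star> coev) \<star> ?x) \<cdot> (r \<star> ?x)"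
    by (simp add: assoc assoc_red[OF associator_nat])
  also have "\<dots> = (?y \<star> right_unitor T X) \<cdot> (?y \<star> (?x \<star> ev)) \<cdot> (?y \<star> associator T X D X) \<cdot>
        (?y \<star> (coev \<star> ?x)) \<cdot> associator T Y ?I X \<cdot> (r \<star> ?x)"
    unfolding pent by (simp add: assoc assoc_red[OF associator_nat])
  also have "\<dots> = ((?y \<star> right_unitor T X) \<cdot> (?y \<star> (?x \<star> ev)) \<cdot> (?y \<star> associator T X D X) \<cdot>
        (?y \<star> (coev \<star> ?x))) \<cdot> associator T Y ?I X \<cdot> (r \<star> ?x)"
    by (simp add: assoc)
  also have "\<dots> = (?y \<star> left_unitor T X) \<cdot> associator T Y ?I X \<cdot> (r \<star> ?x)"
    by (simp add: tensor_arrow_cmp zigzag)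
  also have "\<dots> = ident T (Y \<boxtimes> X)"
    by (simp add: assoc_red[OF unit_triangle] tensor_arrow_cmp r tensor_ident)
  finally have counit: "right_unitor T (Y \<boxtimes> X) \<cdot> (ident T (Y \<boxtimes> X) \<star> ev) \<cdot>
      associator T (Y \<boxtimes> X) D X \<cdot> (\<eta> \<star> ?x) = ident T (Y \<boxtimes> X)" .
  \<comment> \<open>Naturality of the counit. With \<open>k = \<iota> i\<close> it sends a map
    through \<open>\<iota> i \<otimes> D\<close> to one through \<open>\<iota> i\<close>; with
    \<open>k = f\<close> and \<open>g = \<eta>\<close> it returns \<open>f\<close>.\<close>
  have up_nat: "up ((k \<star> ?d) \<cdot> g) =
      k \<cdot> right_unitor T V \<cdot> (ident T V \<star> ev) \<cdot> associator T V D X \<cdot> (g \<star> ?x)"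
    if [simp]: "src T k = V" "tgt T k = S" "src T g = W" "tgt T g = V \<boxtimes> D" for k g V W
  proof -
    have "up ((k \<star> ?d) \<cdot> g) = right_unitor T S \<cdot> (ident T S \<star> ev) \<cdot> associator T S D X \<cdot>
        ((k \<star> ?d) \<star> ?x) \<cdot> (g \<star> ?x)"
      by (simp add: up_def tensor_arrow_cmp)
    also have "\<dots> = right_unitor T S \<cdot> ((ident T S \<star> ev) \<cdot> (k \<star> (?d \<star> ?x))) \<cdot> associator T V D X \<cdot> (g \<star> ?x)"
      by (simp add: assoc_red[OF associator_nat] assoc)
    also have "\<dots> = right_unitor T S \<cdot> ((k \<star> ident T ?I) \<cdot> (ident T V \<star> ev)) \<cdot> associator T V D X \<cdot> (g \<star> ?x)"
      by (simp add: tensor_arrow_cmp tensor_ident)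
    also have "\<dots> = k \<cdot> right_unitor T V \<cdot> (ident T V \<star> ev) \<cdot> associator T V D X \<cdot> (g \<star> ?x)"
      by (simp add: assoc_red[OF right_unitor_nat] assoc)
    finally show ?thesis .
  qed
  have S': "is_coproduct T I (\<lambda>i. Z i \<boxtimes> D) (S \<boxtimes> D) (\<lambda>i. \<iota> i \<star> ?d)" by (rule tensor_coproduct[OF S])
  have "(f \<star> ?d) \<cdot> \<eta> \<in> finsums T I (\<lambda>i. \<iota> i \<star> ?d) Y (S \<boxtimes> D)"
    by (rule compact_objectD[OF Y S' I]) simp_all
  moreover have "up g \<in> finsums T I \<iota> (Y \<boxtimes> X) S" if "g \<in> finsums T I (\<lambda>i. \<iota> i \<star> ?d) Y (S \<boxtimes> D)" for g
    using that
  proof induction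
    case finsums_zero
    have "up (zero_arrow T Y (S \<boxtimes> D)) = zero_arrow T (Y \<boxtimes> X) S" by (simp add: up_def zero_tensor)
    then show ?case by (simp add: finsums.finsums_zero)
  next
    case (finsums_inj i \<phi>)
    then show ?case by (simp add: up_nat finsums.finsums_inj)
  next
    case (finsums_plus g h)
    note [simp] = finsums_typing[OF S' finsums_plus.hyps(1)] finsums_typing[OF S' finsums_plus.hyps(2)]
    have "up (g \<oplus> h) = up g \<oplus> up h" by (simp add: up_def plus_tensor cmp_plus)
    then show ?case using finsums_plus.IH by (simp add: finsums.finsums_plus)
  qed
  moreover have "up ((f \<star> ?d) \<cdot> \<eta>) = f"
    by (simp add: up_nat[of f "Y \<boxtimes> X" \<eta> Y] counit)
  ultimately show "f \<in> finsums T I \<iota> (Y \<boxtimes> X) S" by metis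
qed

text \<open>The zigzag exhibits \<open>X\<close> as a retract of
  \<open>(X \<otimes> D) \<otimes> X\<close>, which is isomorphic to
  \<open>(X \<otimes> X) \<otimes> D\<close> and therefore lies in \<open>L\<close>.\<close>

lemma localizing_ideal_radical:
  fixes U :: "'u itself"
  assumes inf: "natLeq <o |UNIV :: 'u set|" and cop: "has_small_coproducts U T"
    and L: "localizing_ideal U T L" and X: "rigid T X" "X \<boxtimes> X \<in> L"
  shows "X \<in> L"
proof -
  let ?I = "tunit T" and ?x = "ident T X"
  obtain D ev coev where [simp]: "src T ev = D \<boxtimes> X" "tgt T ev = ?I" "src T coev = ?I" "tgt T coev = X \<boxtimes> D"
    and zigzag: "right_unitor T X \<cdot> (?x \<star> ev) \<cdot> associator T X D X \<cdot> (coev \<star> ?x) = left_unitor T X"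
    using X(1) unfolding rigid_def by auto
  obtain l where [simp]: "src T l = X" "tgt T l = ?I \<boxtimes> X" and l: "left_unitor T X \<cdot> l = ?x"
    using left_unitor_iso[of X] by (auto elim: iso_arrowE)
  have "isomorphic T ((X \<boxtimes> X) \<boxtimes> D) ((X \<boxtimes> D) \<boxtimes> X)" by (rule isomorphic_swap_right)
  then have "(X \<boxtimes> D) \<boxtimes> X \<in> L" using localizing_idealD(2,3)[OF L] X(2) by blast
  moreover have "(right_unitor T X \<cdot> (?x \<star> ev) \<cdot> associator T X D X) \<cdot> ((coev \<star> ?x) \<cdot> l) =
      (right_unitor T X \<cdot> (?x \<star> ev) \<cdot> associator T X D X \<cdot> (coev \<star> ?x)) \<cdot> l"
    by (simp add: assoc)
  ultimately show ?thesis
    by (intro localizing_retract[OF inf cop localizing_idealD(1)[OF L], of "(X \<boxtimes> D) \<boxtimes> X"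
          "(coev \<star> ?x) \<cdot> l" X "right_unitor T X \<cdot> (?x \<star> ev) \<cdot> associator T X D X"])
      (simp_all add: zigzag l)
qed

end

section \<open>Prime ideals\<close>

text \<open>The elements chosen from are labels \<open>x\<close> of closed sets \<open>Z x\<close>,
  because an object of minimal support is wanted. Without one, dependent choice builds a strictly
  decreasing sequence of closed sets.\<close>

lemma noetherian_minimal:
  assumes "noetherian_space S" "\<And>x. x \<in> A \<Longrightarrow> closedin S (Z x)" "A \<noteq> {}"
  shows "\<exists>x \<in> A. \<forall>y \<in> A. \<not> Z y \<subset> Z x"
proof (rule ccontr)
  assume "\<not> ?thesis"
  then have step: "\<exists>y. y \<in> A \<and> Z y \<subset> Z x" if "x \<in> A" for x using that by blast
  have "\<exists>x. \<forall>n :: nat. x n \<in> A \<and> Z (x (Suc n)) \<subset> Z (x n)"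
    by (rule dependent_nat_choice) (use assms(3) step in auto)
  then obtain x where x: "\<And>n :: nat. x n \<in> A" "\<And>n. Z (x (Suc n)) \<subset> Z (x n)" by blast
  then have "\<forall>n. closedin S (Z (x n)) \<and> Z (x (Suc n)) \<subseteq> Z (x n)"
    using assms(2) psubset_imp_subset by auto
  then obtain N where N: "\<forall>n\<ge>N. Z (x n) = Z (x N)"
    using assms(1)[unfolded noetherian_space_def, rule_format, of "\<lambda>n. Z (x n)"] by blast
  have "Z (x (Suc N)) = Z (x N)" by (rule N[rule_format]) simp
  then show False using x(2)[of N] by simp
qed

text \<open>An infinite universe supplies the countable coproducts of the swindle. That compact
  means rigid brings in duals, on which compactness of tensor products and radicality rest.\<close>

locale rigidly_compactly_generated_category = tensor_triangulated_category T
  for T :: "('o, 'a, 'm) tt_cat_scheme" (structure) +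
  fixes U :: "'u itself"
  assumes infinite_universe: "natLeq <o |UNIV :: 'u set|"
    and small_coproducts: "has_small_coproducts U T"
    and compact_iff_rigid: "compact_object U T X \<longleftrightarrow> rigid T X"
begin

abbreviation "Tc \<equiv> compact_part U T"

lemma compact_tensor: "\<lbrakk>X \<in> Tc; Y \<in> Tc\<rbrakk> \<Longrightarrow> X \<boxtimes> Y \<in> Tc"
  using compact_tensor_rigid compact_iff_rigid by (auto simp: compact_part_def)

lemma compact_unit: "tunit T \<in> Tc"
  using rigid_unit compact_iff_rigid by (simp add: compact_part_def)

lemma thick_idealD:
  assumes "thick_ideal U T J"
  shows "J \<subseteq> Tc" "triangulated_subcategory T J" "\<lbrakk>X \<in> J; Y \<in> Tc\<rbrakk> \<Longrightarrow> X \<boxtimes> Y \<in> J"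
    "\<lbrakk>is_biproduct T B X Y; B \<in> J\<rbrakk> \<Longrightarrow> X \<in> J \<and> Y \<in> J"
    "\<lbrakk>isomorphic T X Y; X \<in> J\<rbrakk> \<Longrightarrow> Y \<in> J"
  using assms triangulated_subcategoryD(2) unfolding thick_ideal_def by blast+

text \<open>Closure under summands combines the swindle, for membership in \<open>M\<close>, with
  the fact that retracts of compact objects are compact.\<close>

lemma thick_ideal_Int_compact:
  assumes M: "localizing_ideal U T M"
  shows "thick_ideal U T (M \<inter> Tc)"
  unfolding thick_ideal_def
proof (intro conjI allI impI ballI; (elim conjE)?)
  show "triangulated_subcategory T (M \<inter> Tc)"
    using triangulated_Int triangulated_compact_part localizing_triangulated localizing_idealD(1)[OF M]
    by blast
  have "Z \<in> M \<inter> Tc" if B: "is_biproduct T B X Y" "B \<in> M \<inter> Tc" "Z = X \<or> Z = Y" for B X Y Z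
  proof -
    obtain i p where r: "src T i = Z" "tgt T i = B" "src T p = B" "tgt T p = Z" "p \<cdot> i = ident T Z"
      using biproduct_retract[OF B(1,3)] .
    have "Z \<in> M"
      by (rule localizing_retract[OF infinite_universe small_coproducts localizing_idealD(1)[OF M] _ r])
        (use B in blast)
    moreover have "compact_object U T Z"
      by (rule compact_retract[OF _ r]) (use B in \<open>simp add: compact_part_def\<close>)
    ultimately show ?thesis by (simp add: compact_part_def)
  qed
  then show "X \<in> M \<inter> Tc" "Y \<in> M \<inter> Tc" if "is_biproduct T B X Y" "B \<in> M \<inter> Tc" for B X Y
    using that by blast+
  show "X \<boxtimes> Y \<in> M \<inter> Tc" if "X \<in> M \<inter> Tc" "Y \<in> Tc" for X Y
    using that compact_tensor localizing_idealD(2)[OF M] by blast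
qed simp

text \<open>The ideal quotient of \<open>J\<close> by \<open>W\<close> within the compact objects;
  enlarging a maximal ideal in this way is what forces it to be prime.\<close>

lemma thick_ideal_vimage:
  assumes J: "thick_ideal U T J"
  shows "thick_ideal U T {X \<in> Tc. X \<boxtimes> W \<in> J}"
  unfolding thick_ideal_def
proof (intro conjI allI impI ballI; (elim conjE)?)
  have "{X \<in> Tc. X \<boxtimes> W \<in> J} = Tc \<inter> {X. X \<boxtimes> W \<in> J}" by blast
  then show "triangulated_subcategory T {X \<in> Tc. X \<boxtimes> W \<in> J}"
    by (simp only: triangulated_Int[OF triangulated_compact_part
          triangulated_tensor_vimage[OF thick_idealD(2)[OF J]]])
  have "Z \<in> {X \<in> Tc. X \<boxtimes> W \<in> J}"
    if B: "is_biproduct T B X Y" "B \<in> {X \<in> Tc. X \<boxtimes> W \<in> J}" "Z = X \<or> Z = Y" for B X Y Z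
  proof -
    obtain i p where r: "src T i = Z" "tgt T i = B" "src T p = B" "tgt T p = Z" "p \<cdot> i = ident T Z"
      using biproduct_retract[OF B(1,3)] .
    have "compact_object U T Z"
      by (rule compact_retract[OF _ r]) (use B in \<open>simp add: compact_part_def\<close>)
    moreover have "Z \<boxtimes> W \<in> J" using thick_idealD(4)[OF J biproduct_tensor[OF B(1)]] B(2,3) by blast
    ultimately show ?thesis by (simp add: compact_part_def)
  qed
  then show "X \<in> {X \<in> Tc. X \<boxtimes> W \<in> J}" "Y \<in> {X \<in> Tc. X \<boxtimes> W \<in> J}"
    if "is_biproduct T B X Y" "B \<in> {X \<in> Tc. X \<boxtimes> W \<in> J}" for B X Y
    using that by blast+
  show "X \<boxtimes> Y \<in> {X \<in> Tc. X \<boxtimes> W \<in> J}" if "X \<in> {X \<in> Tc. X \<boxtimes> W \<in> J}" "Y \<in> Tc" for X Y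
    using that compact_tensor thick_idealD(3)[OF J] thick_idealD(5)[OF J isomorphic_swap_right]
    by blast
qed blast

text \<open>Each closure condition has at most two members of the union as premises, and in a chain
  these lie in a common ideal.\<close>

lemma thick_ideal_Union:
  assumes chain: "subset.chain {J. thick_ideal U T J} \<C>" and "\<C> \<noteq> {}"
  shows "thick_ideal U T (\<Union> \<C>)"
  unfolding thick_ideal_def
proof (intro conjI)
  have thick: "thick_ideal U T J" if "J \<in> \<C>" for J
    using chain that by (auto simp: subset_chain_def)
  have tri: "triangulated_subcategory T J" if "J \<in> \<C>" for J using thick_idealD(2) thick that by blast
  have "tgt T g \<in> \<Union> \<C>" if d: "dist T f g h" "src T f \<in> \<Union> \<C>" "tgt T f \<in> \<Union> \<C>" for f g h
  proof -
    obtain J where "J \<in> \<C>" "src T f \<in> J" "tgt T f \<in> J"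
      using d(2,3) chain unfolding subset_chain_def by blast
    then show ?thesis using triangulated_subcategoryD(4)[OF tri d(1)] by blast
  qed
  moreover have "X \<in> \<Union> \<C>" if "is_zero T X" for X
    using that triangulated_subcategoryD(1)[OF tri] \<open>\<C> \<noteq> {}\<close> by blast
  moreover have "Y \<in> \<Union> \<C>" if "X \<in> \<Union> \<C>" "isomorphic T X Y" for X Y
    using that triangulated_subcategoryD(2)[OF tri] by blast
  moreover have "susp T X \<in> \<Union> \<C> \<longleftrightarrow> X \<in> \<Union> \<C>" for X
    using triangulated_subcategoryD(3)[OF tri] by blast
  ultimately show "triangulated_subcategory T (\<Union> \<C>)"
    unfolding triangulated_subcategory_def by blast
  show "\<Union> \<C> \<subseteq> Tc" using thick_idealD(1)[OF thick] by blast
  show "\<forall>B X Y. is_biproduct T B X Y \<and> B \<in> \<Union> \<C> \<longrightarrow> X \<in> \<Union> \<C> \<and> Y \<in> \<Union> \<C>"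
    using thick_idealD(4)[OF thick] by blast
  show "\<forall>X \<in> \<Union> \<C>. \<forall>Y \<in> Tc. X \<boxtimes> Y \<in> \<Union> \<C>" using thick_idealD(3)[OF thick] by blast
qed

section \<open>Existence of primes and radicality\<close>

lemma prime_idealD:
  assumes "P \<in> prime_ideals U T"
  shows "thick_ideal U T P" "\<lbrakk>X \<in> Tc; Y \<in> Tc; X \<boxtimes> Y \<in> P\<rbrakk> \<Longrightarrow> X \<in> P \<or> Y \<in> P"
  using assms by (auto simp: prime_ideals_def)

text \<open>As in commutative algebra, an ideal maximal among those containing \<open>J\<close> and
  disjoint from the multiplicative set \<open>A\<close> is prime.\<close>

lemma ex_prime_ideal:
  assumes J: "thick_ideal U T J" and A: "A \<noteq> {}" "A \<subseteq> Tc" "J \<inter> A = {}"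
    and mult: "\<And>X Y. \<lbrakk>X \<in> A; Y \<in> A\<rbrakk> \<Longrightarrow> X \<boxtimes> Y \<in> A"
  obtains P where "P \<in> prime_ideals U T" "J \<subseteq> P" "P \<inter> A = {}"
proof -
  let ?\<A> = "{K. thick_ideal U T K \<and> J \<subseteq> K \<and> K \<inter> A = {}}"
  have "\<exists>P \<in> ?\<A>. \<forall>K \<in> ?\<A>. P \<subseteq> K \<longrightarrow> K = P"
  proof (rule subset_Zorn_nonempty)
    show "?\<A> \<noteq> {}" using J A by blast
    fix \<C> assume "\<C> \<noteq> {}" and chain: "subset.chain ?\<A> \<C>"
    from chain have "subset.chain {J. thick_ideal U T J} \<C>" by (auto simp: subset_chain_def)
    then have "thick_ideal U T (\<Union> \<C>)" using \<open>\<C> \<noteq> {}\<close> by (rule thick_ideal_Union)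
    then show "\<Union> \<C> \<in> ?\<A>" using chain \<open>\<C> \<noteq> {}\<close> unfolding subset_chain_def by blast
  qed
  then obtain P where P: "thick_ideal U T P" "J \<subseteq> P" "P \<inter> A = {}"
    and max: "\<And>K. \<lbrakk>thick_ideal U T K; P \<subseteq> K; K \<inter> A = {}\<rbrakk> \<Longrightarrow> K = P"
    by (smt (verit) mem_Collect_eq subset_trans)
  \<comment> \<open>The quotient of \<open>P\<close> by \<open>W\<close> contains \<open>P\<close>
    and also \<open>V\<close>, so it is strictly larger and by maximality meets \<open>A\<close>.
    Used twice below, this replaces \<open>X\<close> and then \<open>Y\<close> by elements of
    \<open>A\<close>.\<close>
  have meets: "\<exists>a \<in> A. a \<boxtimes> W \<in> P" if "V \<in> Tc" "W \<in> Tc" "V \<notin> P" "V \<boxtimes> W \<in> P" for V W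
  proof (rule ccontr)
    assume "\<not> ?thesis"
    then have "{X \<in> Tc. X \<boxtimes> W \<in> P} = P"
      by (intro max thick_ideal_vimage P(1)) (use thick_idealD(1,3)[OF P(1)] that in blast)+
    with that show False by blast
  qed
  have "X \<in> P \<or> Y \<in> P" if XY: "X \<in> Tc" "Y \<in> Tc" "X \<boxtimes> Y \<in> P" for X Y
  proof (rule ccontr)
    assume contra: "\<not> (X \<in> P \<or> Y \<in> P)"
    then obtain a where a: "a \<in> A" "a \<boxtimes> Y \<in> P" using meets XY by blast
    have "Y \<boxtimes> a \<in> P" using thick_idealD(5)[OF P(1) isomorphic_symm a(2)] .
    then obtain b where "b \<in> A" "b \<boxtimes> a \<in> P" using meets[of Y a] contra XY a A(2) by blast
    then show False using mult a P(3) by blast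
  qed
  moreover have "P \<noteq> Tc" using A P(3) by blast
  ultimately have "P \<in> prime_ideals U T" using P(1) unfolding prime_ideals_def by blast
  then show thesis using that P by blast
qed

text \<open>The tensor powers of \<open>X\<close> in all bracketings. As the tensor product is
  associative only up to isomorphism, this set is literally multiplicative where a sequence of
  chosen powers would not be.\<close>

inductive_set tensor_words :: "'o \<Rightarrow> 'o set" for X where
  tensor_words_base: "X \<in> tensor_words X"
| tensor_words_mult: "\<lbrakk>V \<in> tensor_words X; W \<in> tensor_words X\<rbrakk> \<Longrightarrow> V \<boxtimes> W \<in> tensor_words X"

text \<open>The induction varies the ideal: \<open>V \<otimes> W \<in> M\<close> puts
  \<open>V\<close> into the quotient of \<open>M\<close> by \<open>W\<close>, hence \<open>X\<close>
  too. Repeating this with \<open>W\<close> and the quotient by \<open>X\<close> gives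
  \<open>X \<otimes> X \<in> M\<close>.\<close>

lemma tensor_words_radical:
  assumes "W \<in> tensor_words X" and X: "X \<in> Tc" and "localizing_ideal U T M" "W \<in> M"
  shows "X \<in> M"
  using assms(1,3,4)
proof (induction arbitrary: M)
  case tensor_words_base
  then show ?case by simp
next
  case (tensor_words_mult V W)
  note M = tensor_words_mult.prems(1)
  have "X \<in> {Z. Z \<boxtimes> W \<in> M}"
    by (rule tensor_words_mult.IH(1)[OF localizing_ideal_vimage[OF M]]) (use tensor_words_mult in simp)
  then have "W \<boxtimes> X \<in> M" using localizing_idealD(3)[OF M isomorphic_symm] by simp
  then have "X \<in> {Z. Z \<boxtimes> X \<in> M}"
    by (intro tensor_words_mult.IH(2)[OF localizing_ideal_vimage[OF M]]) simp
  moreover have "rigid T X" using X compact_iff_rigid by (simp add: compact_part_def)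
  ultimately show "X \<in> M"
    using localizing_ideal_radical[OF infinite_universe small_coproducts M] by simp
qed

lemma prime_ideal_separation:
  assumes M: "localizing_ideal U T M" and X: "X \<in> Tc" "X \<notin> M"
  obtains P where "P \<in> prime_ideals U T" "M \<inter> Tc \<subseteq> P" "X \<notin> P"
proof -
  have "W \<in> Tc" if "W \<in> tensor_words X" for W
    using that by induction (use X compact_tensor in auto)
  moreover have "M \<inter> Tc \<inter> tensor_words X = {}" using tensor_words_radical M X by blast
  ultimately obtain P where "P \<in> prime_ideals U T" "M \<inter> Tc \<subseteq> P" "P \<inter> tensor_words X = {}"
    using ex_prime_ideal[OF thick_ideal_Int_compact[OF M], of "tensor_words X"]
    by (metis tensor_words.intros emptyE subsetI)
  then show thesis using that tensor_words_base by blast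
qed

section \<open>The local-to-global principle\<close>

text \<open>The generating open sets cover all primes because a zero object lies in every prime and
  so has empty support.\<close>

lemma topspace_Spc: "topspace (Spc U T) = prime_ideals U T"
proof -
  obtain Z where Z: "is_zero T Z" using ex_zero_object by blast
  then have "Z \<in> Tc" using compact_zero by (simp add: compact_part_def)
  moreover have "supp U T Z = {}"
    using Z triangulated_subcategoryD(1) thick_idealD(2) prime_idealD(1) unfolding supp_def by blast
  ultimately have "\<Union> {prime_ideals U T - supp U T X | X. X \<in> Tc} = prime_ideals U T" by blast
  then show ?thesis unfolding Spc_def topology_generated_by_topspace .
qed

lemma closedin_supp: "X \<in> Tc \<Longrightarrow> closedin (Spc U T) (supp U T X)"
  unfolding closedin_def topspace_Spc
  by (auto simp: Spc_def supp_def intro: topology_generated_by_Basis)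

lemma supp_tensor: "\<lbrakk>X \<in> Tc; Y \<in> Tc\<rbrakk> \<Longrightarrow> supp U T (X \<boxtimes> Y) \<subseteq> supp U T X \<inter> supp U T Y"
  unfolding supp_def using thick_idealD(3,5) prime_idealD(1) isomorphic_symm by blast

text \<open>A generating open set consists of the primes that contain a given compact object, hence
  is closed under passing to larger primes. Open sets inherit this, and closed sets are closed under
  passing to smaller primes.\<close>

lemma closedin_specialization:
  assumes "closedin (Spc U T) Z" "P \<in> Z" "Q \<in> prime_ideals U T" "Q \<subseteq> P"
  shows "Q \<in> Z"
proof (rule ccontr)
  assume "Q \<notin> Z"
  have P: "P \<in> prime_ideals U T" using closedin_subset[OF assms(1)] assms(2) topspace_Spc by blast
  have "generate_topology_on {prime_ideals U T - supp U T X | X. X \<in> Tc} V \<Longrightarrow> Q \<in> V \<Longrightarrow> P \<in> V" for V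
    by (induction rule: generate_topology_on.induct) (use P assms in \<open>auto simp: supp_def\<close>)
  moreover have "openin (Spc U T) (prime_ideals U T - Z)"
    using assms(1) unfolding closedin_def topspace_Spc by blast
  ultimately show False
    using \<open>Q \<notin> Z\<close> assms(2,3) unfolding Spc_def openin_topology_generated_by_iff by blast
qed

text \<open>Tensored with \<open>X\<close>, the triangle has \<open>e \<otimes> X\<close> and
  \<open>f \<otimes> X\<close> as outer terms and \<open>\<one> \<otimes> X\<close>, a copy of
  \<open>X\<close>, in the middle.\<close>

lemma idempotent_triangle_cancel:
  assumes "idempotent_triangle U T Y e f" "triangulated_subcategory T L" "e \<boxtimes> X \<in> L" "f \<boxtimes> X \<in> L"
  shows "X \<in> L"
proof -
  obtain a b c where abc: "src T a = e" "tgt T a = tunit T" "tgt T b = f" "dist T a b c"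
    using assms(1) unfolding idempotent_triangle_def by auto
  have "tunit T \<boxtimes> X \<in> L"
    using triangulated_subcategory_middle[OF assms(2) tensor_exact[OF abc(4), of e "tunit T" X]] abc assms
    by simp
  then show ?thesis using triangulated_subcategoryD(2)[OF assms(2) isomorphic_left_unitor] by blast
qed

text \<open>
  A compact object outside \<open>M\<close> of minimal support is supported on the closure of a single point \<open>P\<close>,
  so \<open>g(P)\<close> only misses its part supported on \<open>Y\<^sub>2\<close>, which lies in \<open>M\<close> by minimality.
\<close>

lemma unit_in_localizing_ideal:
  assumes M: "localizing_ideal U T M" and noeth: "noetherian_space (Spc U T)"
    and ef: "idempotent_choice U T e f"
    and g: "\<And>P. P \<in> prime_ideals U T \<Longrightarrow> point_idempotent U T e f P (g P) \<and> g P \<in> M"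
  shows "tunit T \<in> M"
proof (rule ccontr)
  assume "tunit T \<notin> M"
  then have "\<exists>X \<in> Tc - M. \<forall>X' \<in> Tc - M. \<not> supp U T X' \<subset> supp U T X"
    using compact_unit closedin_supp by (intro noetherian_minimal[OF noeth]) auto
  then obtain X where X: "X \<in> Tc" "X \<notin> M"
    and min: "\<And>X'. \<lbrakk>X' \<in> Tc; supp U T X' \<subset> supp U T X\<rbrakk> \<Longrightarrow> X' \<in> M"
    by (elim bexE) (metis DiffD1 DiffD2 DiffI)
  obtain P where P: "P \<in> prime_ideals U T" "M \<inter> Tc \<subseteq> P" "X \<notin> P"
    using prime_ideal_separation[OF M X] .
  \<comment> \<open>Here minimality enters: tensoring with an object of \<open>Q\<close> removes
    \<open>Q\<close> from the support. This serves below for an arbitrary \<open>Q\<close> in the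
    support of \<open>X\<close> and for \<open>Q = P\<close>.\<close>
  have annihilated: "Y \<boxtimes> X \<in> M" if "Y \<in> Tc" "Q \<in> supp U T X" "Y \<in> Q" for Y Q
  proof (rule min)
    have "Q \<notin> supp U T Y" using that by (simp add: supp_def)
    then show "supp U T (Y \<boxtimes> X) \<subset> supp U T X" using supp_tensor that X by blast
  qed (use that X compact_tensor in blast)
  have P_supp: "P \<in> supp U T X" using P by (simp add: supp_def)
  obtain Y1 Y2 where Y: "thomason (Spc U T) Y1" "thomason (Spc U T) Y2" "P \<in> Y1" "P \<notin> Y2"
    and gP: "g P = e Y1 \<boxtimes> f Y2"
    using g[OF P(1)] unfolding point_idempotent_def by blast
  have tri1: "idempotent_triangle U T Y1 (e Y1) (f Y1)" and tri2: "idempotent_triangle U T Y2 (e Y2) (f Y2)"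
    using ef Y unfolding idempotent_choice_def by blast+
  have "supp U T X \<subseteq> Y1"
  proof
    fix Q assume Q: "Q \<in> supp U T X"
    then have Q': "Q \<in> prime_ideals U T" by (simp add: supp_def)
    \<comment> \<open>For the inclusion \<open>Q \<subseteq> P\<close>: the product
      \<open>Y \<otimes> X\<close> lies in \<open>M\<close>, hence in the prime \<open>P\<close>,
      which omits \<open>X\<close>. A closed piece of \<open>Y1\<close> containing \<open>P\<close>
      then contains \<open>Q\<close>.\<close>
    have "Y \<in> P" if "Y \<in> Q" for Y
    proof -
      have Y: "Y \<in> Tc" using thick_idealD(1)[OF prime_idealD(1)[OF Q']] that by blast
      then have "Y \<boxtimes> X \<in> P" using annihilated Q that P(2) compact_tensor X(1) by blast
      then show ?thesis using prime_idealD(2)[OF P(1) Y X(1)] P(3) by blast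
    qed
    then show "Q \<in> Y1"
      using Y(1,3) closedin_specialization Q' unfolding thomason_def by blast
  qed
  then have "X \<in> compact_supported U T Y1" using X by (simp add: compact_supported_def)
  then have "X \<in> Loc U T (compact_supported U T Y1)" by (auto simp: Loc_def)
  then have f1: "is_zero T (f Y1 \<boxtimes> X)" using tri1 unfolding idempotent_triangle_def by blast
  let ?N = "{Z. Z \<boxtimes> f Y2 \<in> M}"
  have N: "localizing_ideal U T ?N" by (rule localizing_ideal_vimage[OF M])
  note N_tri = localizing_triangulated[OF localizing_idealD(1)[OF N]]
  \<comment> \<open>This is \<open>g P \<in> M\<close> with the factor \<open>f Y2\<close> absorbed
    into the ideal. As \<open>f Y1\<close> annihilates \<open>X\<close>, the triangle of
    \<open>Y1\<close> can now exchange \<open>e Y1\<close> for \<open>X\<close>.\<close>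
  have "e Y1 \<in> ?N" using g[OF P(1)] gP by simp
  then have "e Y1 \<boxtimes> X \<in> ?N" by (rule localizing_idealD(2)[OF N])
  moreover have "f Y1 \<boxtimes> X \<in> ?N" using f1 by (rule triangulated_subcategoryD(1)[OF N_tri])
  ultimately have "X \<in> ?N" by (rule idempotent_triangle_cancel[OF tri1 N_tri])
  then have "f Y2 \<boxtimes> X \<in> M" using localizing_idealD(3)[OF M isomorphic_symm] by simp
  moreover have "e Y2 \<boxtimes> X \<in> M"
  proof -
    have "localizing U T {Z. Z \<boxtimes> X \<in> M}"
      by (rule localizing_tensor_vimage[OF localizing_idealD(1)[OF M]])
    moreover have "compact_supported U T Y2 \<subseteq> {Z. Z \<boxtimes> X \<in> M}"
    proof
      fix Y assume "Y \<in> compact_supported U T Y2"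
      then have "Y \<in> Tc" "Y \<in> P" using Y(4) P(1) by (auto simp: compact_supported_def supp_def)
      then show "Y \<in> {Z. Z \<boxtimes> X \<in> M}" using annihilated P_supp by simp
    qed
    ultimately have "Loc U T (compact_supported U T Y2) \<subseteq> {Z. Z \<boxtimes> X \<in> M}" by (auto simp: Loc_def)
    \<comment> \<open>The ideal generated by \<open>e Y2\<close> equals the plain localizing
      subcategory generated by the compact objects supported on \<open>Y2\<close>, so checking those
      objects was enough.\<close>
    moreover have "e Y2 \<in> Loc_tensor U T {e Y2}" by (auto simp: Loc_tensor_def)
    then have "e Y2 \<in> Loc U T (compact_supported U T Y2)"
      using tri2 unfolding idempotent_triangle_def by blast
    ultimately show ?thesis by blast
  qed
  ultimately have "X \<in> M"
    using idempotent_triangle_cancel[OF tri2 localizing_triangulated[OF localizing_idealD(1)[OF M]]]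
    by simp
  with X(2) show False ..
qed

end

theorem theoremB:
  fixes T :: "('o, 'a) tt_cat"
    and e f :: "'o set set \<Rightarrow> 'o"
    and g :: "'o set \<Rightarrow> 'o"
    and t :: 'o
  assumes "universe TYPE('u)"
    and "rigidly_compactly_generated TYPE('u) T"
    and "noetherian_space (Spc TYPE('u) T)"
    and "idempotent_choice TYPE('u) T e f"
    and "\<And>P. P \<in> prime_ideals TYPE('u) T \<Longrightarrow> point_idempotent TYPE('u) T e f P (g P)"
  shows "Loc_tensor TYPE('u) T {t} =
         Loc_tensor TYPE('u) T {tensor T t (g P) | P. P \<in> prime_ideals TYPE('u) T}"
proof -
  interpret tensor_triangulated_category T
    using assms(2) by (simp add: rigidly_compactly_generated_def)
  interpret rigidly_compactly_generated_category T "TYPE('u)"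
    by unfold_locales
      (use assms(1,2) in \<open>auto simp: rigidly_compactly_generated_def compactly_generated_def universe_def\<close>)
  \<comment> \<open>Any ideal containing \<open>t\<close> contains every
    \<open>t \<otimes> g(P)\<close>. With the converse shown here, both sides are intersections over
    the same family of ideals.\<close>
  have "t \<in> L" if L: "localizing_ideal TYPE('u) T L"
    and gL: "{tensor T t (g P) | P. P \<in> prime_ideals TYPE('u) T} \<subseteq> L" for L
  proof -
    \<comment> \<open>The quotient ideal has \<open>t\<close> on the right, so the factors of
      \<open>t \<otimes> g(P)\<close> are exchanged by the symmetry.\<close>
    have "g P \<in> {X. tensor T X t \<in> L}" if "P \<in> prime_ideals TYPE('u) T" for P
      using gL that localizing_idealD(3)[OF L isomorphic_symm] by blast
    then have "tunit T \<in> {X. tensor T X t \<in> L}"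
      using unit_in_localizing_ideal[OF localizing_ideal_vimage[OF L] assms(3,4)] assms(5) by blast
    then show ?thesis using localizing_idealD(3)[OF L isomorphic_left_unitor] by simp
  qed
  then show ?thesis
    unfolding Loc_tensor_def using localizing_idealD(2)[where U = "TYPE('u)"] by blast
qed

end
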